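(* Let $f(X)\in\mathbb{Z}[X]$ be a polynomial of degree $n\geq 2$ with non-zero discriminant $D(f)$. Let $0<\epsilon<1/n$ and let $S$ be a finite set of primes. For a prime $p$ let $g_p$ be the largest integer $g$ with $p^g\mid D(f)$. Let $s'$ be the number of primes $p\in S$ such that the congruence $f(x)\equiv 0\pmod{p^{g_p+1}}$ is solvable in $x\in\mathbb{Z}$, and assume $s'>0$. For $B>0$ let $N(f,S,\epsilon,B)$ be the number of integers $x$ with \[ |x|\leq B,\quad f(x)\neq 0,\quad [f(x)]_S\geq |f(x)|^{\epsilon}. \] Then there are constants $0<c<C$ depending only on $f,S,\epsilon$ such that for all sufficiently large $B$, \[ c\,B^{1-n\epsilon}(\log B)^{s'-1}\leq N(f,S,\epsilon,B)\leq C\,B^{1-n\epsilon}(\log B)^{s'-1}. \]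
   Context: For a finite set of primes $S$ and a non-zero integer $m$, the $S$-part of $m$ is $[m]_S:=\prod_{p\in S}p^{a_p}$, where $p^{a_p}$ is the exact power of $p$ dividing $m$. *)

theory Defs
  imports
    Complex_Main
    "HOL-Number_Theory.Cong"
    "Subresultants.Resultant_Prelim"
begin

text \<open>
  For \<open>f\<close> of degree \<open>n \<ge> 1\<close> with leading coefficient \<open>a\<close>, the discriminant is
  \<open>(-1)^(n(n-1)/2) * Res(f, f') / a\<close>, i.e. \<open>a^(2n-2)\<close> times the product of the squared
  differences of the roots. The two integer divisions are exact; for the second one
  see \<open>lead_coeff_mult_poly_discriminant\<close>.
\<close>

definition poly_discriminant :: "int poly \<Rightarrow> int" where
  "poly_discriminant f =
     (-1) ^ (degree f * (degree f - 1) div 2) * (resultant f (pderiv f) div lead_coeff f)"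

lemma lead_coeff_dvd_resultant_pderiv:
  fixes f :: "int poly"
  assumes "degree f > 0"
  shows "lead_coeff f dvd resultant f (pderiv f)"
proof -
  let ?A = "sylvester_mat f (pderiv f)"
  let ?d = "degree f + degree (pderiv f)"
  have entry: "lead_coeff f dvd ?A $$ (i, 0)" if i: "i < ?d" for i
  proof -
    have "i = degree f - 1" if "\<not> i < degree (pderiv f)" "i - degree (pderiv f) \<le> 0"
      using that by (simp add: degree_pderiv)
    moreover have "lead_coeff f dvd coeff (pderiv f) (degree f - 1)"
      using assms by (simp add: coeff_pderiv)
    ultimately show ?thesis
      using assms i by (subst sylvester_index_mat) auto
  qed
  have "resultant f (pderiv f) = (\<Sum>i<?d. ?A $$ (i, 0) * cofactor ?A i 0)"
    unfolding resultant_def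
    using assms by (intro laplace_expansion_column[OF sylvester_carrier_mat]) simp
  also have "lead_coeff f dvd \<dots>"
    by (intro dvd_sum dvd_mult2 entry) simp
  finally show ?thesis .
qed

lemma lead_coeff_mult_poly_discriminant:
  assumes "degree f > 0"
  shows "lead_coeff f * poly_discriminant f =
           (-1) ^ (degree f * (degree f - 1) div 2) * resultant f (pderiv f)"
  using lead_coeff_dvd_resultant_pderiv[OF assms]
  by (simp add: poly_discriminant_def mult.left_commute)

definition S_part :: "nat set \<Rightarrow> int \<Rightarrow> nat" where
  "S_part S m = (\<Prod>p\<in>S. p ^ multiplicity (int p) m)"

definition count_large_S_part :: "int poly \<Rightarrow> nat set \<Rightarrow> real \<Rightarrow> real \<Rightarrow> nat" where
  "count_large_S_part f S \<epsilon> B =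
     card {x :: int. \<bar>real_of_int x\<bar> \<le> B \<and> poly f x \<noteq> 0 \<and>
       real (S_part S (poly f x)) \<ge> real_of_int \<bar>poly f x\<bar> powr \<epsilon>}"

end

theory Submission
  imports Defs "HOL-Real_Asymp.Real_Asymp"
begin

text \<open>
  Let \<open>T\<close> be the set of the \<open>s'\<close> primes in \<open>S\<close> for which \<open>f \<equiv> 0\<close> is solvable modulo
  \<open>p ^ (g p + 1)\<close>. For every integer \<open>x\<close> the discriminant lies in the ideal generated by \<open>f x\<close>
  and \<open>(f' x)\<^sup>2\<close>, so Hensel lifting starts at any such solution, and for \<open>p \<in> T\<close> all large
  exponents occur as exact \<open>p\<close>-adic valuations of values of \<open>f\<close>. For the primes in \<open>S - T\<close> these
  valuations are bounded, so that only the \<open>T\<close>-part of \<open>f x\<close> matters.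

  For the upper bound, the \<open>T\<close>-part of \<open>f x\<close> with \<open>B / 2 < \<bar>x\<bar> \<le> B\<close> is at least a constant times
  \<open>B powr (n \<epsilon>)\<close>, hence has a divisor \<open>m\<close> within a constant factor of that size. There are
  \<open>O((log B) ^ (s' - 1))\<close> such \<open>m\<close>, and each one divides \<open>f x\<close> for \<open>O(B / m)\<close> integers \<open>x\<close>, because
  \<open>f\<close> has boundedly many zeros modulo \<open>m\<close>. For the lower bound, each of the many \<open>m\<close> of
  size about \<open>B powr (n \<epsilon>)\<close> is the exact \<open>T\<close>-part of \<open>f x\<close> on a residue class
  modulo \<open>m\<close> times the product of \<open>T\<close>, and these classes are disjoint.
\<close>

subsection \<open>The discriminant as a combination of \<open>f x\<close> and \<open>(f' x)\<^sup>2\<close>\<close>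

lemma replace_col_carrier:
  "A \<in> carrier_mat n n \<Longrightarrow> replace_col A v k \<in> carrier_mat n n"
  by (auto simp: replace_col_def)

text \<open>Column \<open>k\<close> does not enter the cofactors along column \<open>k\<close>, so
  the determinant is linear in the new column \<open>v\<close>.\<close>

lemma det_replace_col:
  fixes A :: "'a :: comm_ring_1 mat"
  assumes "A \<in> carrier_mat n n" "k < n"
  shows "det (replace_col A v k) = (\<Sum>i<n. v $ i * cofactor A i k)"
proof -
  have "mat_delete (replace_col A v k) i k = mat_delete A i k" for i
    using assms by (intro eq_matI) (auto simp: mat_delete_def replace_col_def)
  then have "cofactor (replace_col A v k) i k = cofactor A i k" for i
    by (simp add: cofactor_def)
  then show ?thesis
    using assms by (subst laplace_expansion_column[of _ n k]) (auto simp: replace_col_def)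
qed

lemma dvd_det_of_dvd_column:
  fixes A :: "'a :: comm_ring_1 mat"
  assumes "A \<in> carrier_mat n n" "k < n" "\<And>i. i < n \<Longrightarrow> a dvd A $$ (i, k)"
  shows "a dvd det A"
  by (subst laplace_expansion_column[OF assms(1,2)]) (auto intro!: dvd_sum dvd_mult2 assms(3))


section \<open>Rows of the Sylvester matrix as polynomials evaluated at a point\<close>

lemma poly_eq_sum_lessThan:
  fixes p :: "'a :: comm_semiring_1 poly"
  assumes "degree p < d"
  shows "poly p x = (\<Sum>j<d. coeff p j * x ^ j)"
proof -
  have "(\<Sum>j<d. coeff p j * x ^ j) = (\<Sum>j\<le>degree p. coeff p j * x ^ j)"
    using assms by (intro sum.mono_neutral_right) (auto simp: coeff_eq_0 not_le)
  then show ?thesis by (simp add: poly_altdef)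
qed

lemma poly_pderiv_eq_sum_lessThan:
  fixes p :: "'a :: idom poly"
  assumes "degree p < d"
  shows "poly (pderiv p) x = (\<Sum>j<d. coeff p j * (of_nat j * x ^ (j - 1)))"
proof -
  have "degree (pderiv p) < d"
    using assms degree_pderiv_le[of p] by linarith
  then have "poly (pderiv p) x = (\<Sum>j<d. coeff p (Suc j) * (of_nat (Suc j) * x ^ j))"
    by (simp add: poly_eq_sum_lessThan coeff_pderiv mult_ac)
  also have "\<dots> = (\<Sum>j<Suc d. coeff p j * (of_nat j * x ^ (j - 1)))"
    by (simp only: sum.lessThan_Suc_shift) simp
  also have "\<dots> = (\<Sum>j<d. coeff p j * (of_nat j * x ^ (j - 1)))"
    using assms by (simp add: coeff_eq_0)
  finally show ?thesis .
qed

text \<open>These are the shifts \<open>X ^ k * p\<close>, followed by the shifts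
  \<open>X ^ k * q\<close>, whose coefficients, highest first, form the rows of the Sylvester
  matrix.\<close>

definition sylvester_row :: "'a :: comm_semiring_1 poly \<Rightarrow> 'a poly \<Rightarrow> nat \<Rightarrow> 'a poly" where
  "sylvester_row p q i =
     (if i < degree q then monom 1 (degree q - Suc i) * p
      else monom 1 (degree p + degree q - Suc i) * q)"

lemma degree_sylvester_row:
  fixes p q :: "'a :: idom poly"
  assumes "i < degree p + degree q"
  shows "degree (sylvester_row p q i) < degree p + degree q"
proof -
  have "degree (monom 1 k * r) \<le> k + degree r" for k and r :: "'a poly"
    using degree_mult_le[of "monom 1 k" r] degree_monom_le[of 1 k] by (metis add_le_mono1 le_trans)
  from this[of "degree q - Suc i" p] this[of "degree p + degree q - Suc i" q]
  show ?thesis using assms by (auto simp: sylvester_row_def)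
qed

lemma sylvester_mat_eq_coeff_row:
  fixes p q :: "'a :: comm_semiring_1 poly"
  assumes "i < degree p + degree q" "j < degree p + degree q"
  shows "sylvester_mat p q $$ (i, j) = coeff (sylvester_row p q i) (degree p + degree q - Suc j)"
  using assms
  by (subst sylvester_index_mat2) (auto simp: sylvester_row_def coeff_monom_mult intro!: arg_cong[of _ _ "coeff _"])

text \<open>The weights are reversed because rows list coefficients from the top degree down. With
  \<open>w j = x ^ j\<close> the product evaluates the row polynomials at \<open>x\<close>; with
  \<open>w j = j * x ^ (j - 1)\<close> it evaluates their derivatives.\<close>

lemma sylvester_mat_mult_vec:
  fixes p q :: "'a :: idom poly" and w :: "nat \<Rightarrow> 'a"
  defines "d \<equiv> degree p + degree q"
  assumes "i < d"
  shows "(sylvester_mat p q *\<^sub>v vec d (\<lambda>j. w (d - Suc j))) $ i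
           = (\<Sum>j<d. coeff (sylvester_row p q i) j * w j)"
proof -
  have "(sylvester_mat p q *\<^sub>v vec d (\<lambda>j. w (d - Suc j))) $ i
      = (\<Sum>j<d. coeff (sylvester_row p q i) (d - Suc j) * w (d - Suc j))"
    using assms
    by (auto simp: scalar_prod_def sylvester_mat_eq_coeff_row[folded d_def] atLeast0LessThan
             intro!: sum.cong)
  also have "\<dots> = (\<Sum>j<d. coeff (sylvester_row p q i) j * w j)"
    by (rule sum.nat_diff_reindex)
  finally show ?thesis .
qed


lemma det_replace_col_add:
  fixes A :: "'a :: comm_ring_1 mat"
  assumes "A \<in> carrier_mat n n" "k < n" "\<And>i. i < n \<Longrightarrow> u $ i = a * v $ i + b * w $ i"
  shows "det (replace_col A u k) = a * det (replace_col A v k) + b * det (replace_col A w k)"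
  using assms
  by (simp add: det_replace_col sum_distrib_left sum.distrib[symmetric] algebra_simps)

text \<open>The only possibly non-zero entries of the first column are the leading coefficients of
  \<open>f\<close> and \<open>f'\<close>, and the latter is \<open>degree f\<close> times the
  former.\<close>

lemma lead_coeff_dvd_sylvester_pderiv_column:
  fixes f :: "int poly"
  assumes "degree f > 0" "i < degree f + degree (pderiv f)"
  shows "lead_coeff f dvd sylvester_mat f (pderiv f) $$ (i, 0)"
proof -
  have "i = degree f - 1" if "\<not> i < degree (pderiv f)" "i - degree (pderiv f) \<le> 0"
    using that by (simp add: degree_pderiv)
  moreover have "lead_coeff f dvd coeff (pderiv f) (degree f - 1)"
    using assms by (simp add: coeff_pderiv)
  ultimately show ?thesis
    using assms by (subst sylvester_index_mat) auto
qed

text \<open>By Cramer's rule, the last two columns of the Sylvester matrix can be replaced by the values and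
  the derivatives at \<open>x\<close> of the polynomials \<open>X ^ k * f\<close> and \<open>X ^ k * f'\<close> that form its rows. Modulo
  \<open>f x\<close> these columns are \<open>f' x \<cdot> s\<close> and \<open>f'' x \<cdot> s + f' x \<cdot> r\<close> for suitable \<open>s\<close> and \<open>r\<close>, which yields
  the factor \<open>(f' x)\<^sup>2\<close>; the first column stays divisible by the leading coefficient.\<close>
lemma poly_discriminant_in_ideal:
  fixes f :: "int poly" and x :: int
  assumes "degree f \<ge> 2"
  shows "\<exists>u v. poly_discriminant f = u * poly f x + v * (poly (pderiv f) x)\<^sup>2"
proof -
  define d where "d = degree f + degree (pderiv f)"
  define S where "S = sylvester_mat f (pderiv f)"
  define b where "b = poly (pderiv f) x"
  define c where "c = poly f x"
  define t where "t = poly (pderiv (pderiv f)) x"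
  \<comment> \<open>Row \<open>i\<close> is \<open>X ^ k i\<close> times \<open>f\<close> or
    \<open>f'\<close>.\<close>
  define k where "k i = (if i < degree (pderiv f) then degree (pderiv f) - Suc i else d - Suc i)" for i
  define dx where "dx i = of_nat (k i) * x ^ (k i - 1)" for i
  define s where "s = vec d (\<lambda>i. if i < degree (pderiv f) then 0 else x ^ k i)"
  define e1 where "e1 = vec d (\<lambda>i. if i < degree (pderiv f) then x ^ k i else 0)"
  define e2 where "e2 = vec d (\<lambda>i. if i < degree (pderiv f) then dx i else 0)"
  define r where "r = vec d (\<lambda>i. if i < degree (pderiv f) then x ^ k i else dx i)"
  define w1 where "w1 = vec d (\<lambda>j. x ^ (d - Suc j))"
  define w2 where "w2 = vec d (\<lambda>j. of_nat (d - Suc j) * x ^ (d - Suc j - 1))"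
  have d: "d \<ge> 3" using assms by (simp add: d_def degree_pderiv)
  have S: "S \<in> carrier_mat d d" unfolding S_def d_def by (rule sylvester_carrier_mat)
  have row: "sylvester_row f (pderiv f) i = monom 1 (k i) * (if i < degree (pderiv f) then f else pderiv f)" for i
    by (simp add: sylvester_row_def k_def d_def)
  have deg: "degree (sylvester_row f (pderiv f) i) < d" if "i < d" for i
    using degree_sylvester_row that unfolding d_def by blast
  have Sw1: "(S *\<^sub>v w1) $ i = b * s $ i + c * e1 $ i" if "i < d" for i
  proof -
    have "(S *\<^sub>v w1) $ i = poly (sylvester_row f (pderiv f) i) x"
      using sylvester_mat_mult_vec[of i f "pderiv f" "\<lambda>j. x ^ j"] that
      by (simp add: S_def w1_def d_def[symmetric] poly_eq_sum_lessThan[OF deg])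
    then show ?thesis
      using that by (simp add: row poly_monom s_def e1_def b_def c_def)
  qed
  \<comment> \<open>By the product rule, an upper row contributes
    \<open>b * x ^ k i + c * dx i\<close> and a lower row
    \<open>t * x ^ k i + b * dx i\<close>.\<close>
  have Sw2: "(S *\<^sub>v w2) $ i = 1 * (t \<cdot>\<^sub>v s + b \<cdot>\<^sub>v r) $ i + c * e2 $ i" if "i < d" for i
  proof -
    have "(S *\<^sub>v w2) $ i = poly (pderiv (sylvester_row f (pderiv f) i)) x"
      using sylvester_mat_mult_vec[of i f "pderiv f" "\<lambda>j. of_nat j * x ^ (j - 1)"] that
      by (simp add: S_def w2_def d_def[symmetric] poly_pderiv_eq_sum_lessThan[OF deg])
    then show ?thesis
      using that
      by (simp add: row pderiv_mult pderiv_monom poly_monom s_def r_def e2_def b_def c_def t_def dx_def mult_ac)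
  qed
  define S1 where "S1 = replace_col S s (d - 1)"
  define R1 where "R1 = replace_col S e1 (d - 1)"
  define R2 where "R2 = replace_col S1 e2 (d - 2)"
  define R3 where "R3 = replace_col S1 r (d - 2)"
  have S1: "S1 \<in> carrier_mat d d"
    unfolding S1_def by (rule replace_col_carrier[OF S])
  \<comment> \<open>The two matrices differ only in the last column, where \<open>w2\<close> has
    entry 0.\<close>
  have "S1 *\<^sub>v w2 = S *\<^sub>v w2"
  proof (rule eq_vecI)
    fix i assume "i < dim_vec (S *\<^sub>v w2)"
    then show "(S1 *\<^sub>v w2) $ i = (S *\<^sub>v w2) $ i"
      using S S1 d by (auto simp: scalar_prod_def S1_def replace_col_def w2_def intro!: sum.cong)
  qed (use S S1 in auto)
  \<comment> \<open>Cramer's rule loses nothing here, since entry \<open>d - 2\<close> of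
    \<open>w2\<close> is 1.\<close>
  moreover have "det (replace_col S1 (S1 *\<^sub>v w2) (d - 2)) = w2 $ (d - 2) * det S1"
    using d by (intro cramer_lemma_mat[OF S1]) (auto simp: w2_def)
  ultimately have "det S1 = det (replace_col S1 (S *\<^sub>v w2) (d - 2))"
    using d by (simp add: w2_def)
  also have "\<dots> = 1 * det (replace_col S1 (t \<cdot>\<^sub>v s + b \<cdot>\<^sub>v r) (d - 2)) + c * det R2"
    unfolding R2_def using d by (intro det_replace_col_add[OF S1]) (use Sw2 in auto)
  also have "det (replace_col S1 (t \<cdot>\<^sub>v s + b \<cdot>\<^sub>v r) (d - 2))
      = t * det (replace_col S1 s (d - 2)) + b * det R3"
    unfolding R3_def using d by (intro det_replace_col_add[OF S1]) (auto simp: s_def r_def)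
  \<comment> \<open>Columns \<open>d - 2\<close> and \<open>d - 1\<close> would both equal
    \<open>s\<close>.\<close>
  also have "det (replace_col S1 s (d - 2)) = 0"
    using d S
    by (intro det_identical_columns[of _ d "d - 2" "d - 1"] replace_col_carrier S1)
       (auto simp: S1_def replace_col_def intro!: eq_vecI)
  finally have detS1: "det S1 = b * det R3 + c * det R2" by simp
  have "det (replace_col S (S *\<^sub>v w1) (d - 1)) = w1 $ (d - 1) * det S"
    using d by (intro cramer_lemma_mat[OF S]) (auto simp: w1_def)
  then have "det S = det (replace_col S (S *\<^sub>v w1) (d - 1))"
    using d by (simp add: w1_def)
  also have "\<dots> = b * det S1 + c * det R1"
    unfolding R1_def S1_def using d by (intro det_replace_col_add[OF S]) (use Sw1 in auto)
  finally have detS: "det S = c * (b * det R2 + det R1) + b\<^sup>2 * det R3"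
    by (simp add: detS1 algebra_simps power2_eq_square)
  have col: "lead_coeff f dvd S $$ (i, 0)" if "i < d" for i
    using lead_coeff_dvd_sylvester_pderiv_column[of f i] that assms by (simp add: d_def S_def)
  \<comment> \<open>Only columns \<open>d - 2\<close> and \<open>d - 1\<close> were replaced, and
    \<open>d \<ge> 3\<close> keeps column 0 intact.\<close>
  have "lead_coeff f dvd det R1" "lead_coeff f dvd det R2" "lead_coeff f dvd det R3"
    unfolding R1_def R2_def R3_def using d S S1 col
    by (auto intro!: dvd_det_of_dvd_column[of _ d 0] replace_col_carrier)
       (auto simp: replace_col_def S1_def)
  then obtain A1 A2 A3 where A: "det R1 = lead_coeff f * A1" "det R2 = lead_coeff f * A2" "det R3 = lead_coeff f * A3"
    by (auto elim!: dvdE)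
  let ?sg = "(-1) ^ (degree f * (degree f - 1) div 2) :: int"
  have "lead_coeff f * poly_discriminant f = ?sg * det S"
    using assms by (simp add: lead_coeff_mult_poly_discriminant resultant_def S_def)
  also have "\<dots> = lead_coeff f * ((?sg * (b * A2 + A1)) * c + (?sg * A3) * b\<^sup>2)"
    by (simp add: detS A algebra_simps)
  finally have "poly_discriminant f = (?sg * (b * A2 + A1)) * c + (?sg * A3) * b\<^sup>2"
    using assms by (subst (asm) mult_cancel_left) auto
  then show ?thesis unfolding b_def c_def by blast
qed

subsection \<open>Hensel lifting and congruences\<close>

lemma poly_taylor_second_order:
  fixes f :: "'a :: idom poly"
  shows "\<exists>k. poly f (x + h) = poly f x + h * poly (pderiv f) x + h\<^sup>2 * k"
proof (induction f)
  case (pCons a f)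
  then obtain k where "poly f (x + h) = poly f x + h * poly (pderiv f) x + h\<^sup>2 * k" by blast
  then have "poly (pCons a f) (x + h) = poly (pCons a f) x + h * poly (pderiv (pCons a f)) x
      + h\<^sup>2 * (poly (pderiv f) x + x * k + h * k)"
    by (simp add: pderiv_pCons algebra_simps power2_eq_square)
  then show ?case by blast
qed auto

text \<open>Taylor expansion at \<open>y\<close> gives \<open>D (x - y) \<equiv> - w (x - y)\<^sup>2\<close> modulo \<open>m\<close> for some \<open>w\<close>; since
  \<open>D R\<close> divides \<open>x - y\<close>, moving everything to the left leaves \<open>D (x - y)\<close> times a unit modulo \<open>m\<close>.\<close>
lemma dvd_mult_diff_of_dvd_poly:
  fixes f :: "int poly" and m D R x y :: int
  assumes D: "D = u * poly f y + v * poly (pderiv f) y"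
    and m: "m dvd poly f x" "m dvd poly f y"
    and xy: "D * R dvd x - y" and cop: "\<And>w. coprime m (1 + R * w)"
  shows "m dvd D * (x - y)"
proof -
  obtain k where "poly f (y + (x - y)) = poly f y + (x - y) * poly (pderiv f) y + (x - y)\<^sup>2 * k"
    using poly_taylor_second_order by blast
  then have k: "(x - y) * poly (pderiv f) y = poly f x - poly f y - (x - y)\<^sup>2 * k" by simp
  obtain z where z: "x - y = D * R * z" using xy by blast
  have "D * (x - y) = u * (x - y) * poly f y + v * ((x - y) * poly (pderiv f) y)"
    unfolding D by (simp add: algebra_simps)
  also have "\<dots> = (u * (x - y) - v) * poly f y + v * poly f x - v * k * (x - y)\<^sup>2"
    unfolding k by (simp add: algebra_simps)
  finally have "D * (x - y) + v * k * (x - y)\<^sup>2 = (u * (x - y) - v) * poly f y + v * poly f x"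
    by simp
  moreover have "D * (x - y) + v * k * (x - y)\<^sup>2 = (D * (x - y)) * (1 + R * (v * k * z))"
    unfolding power2_eq_square z by (simp add: algebra_simps)
  ultimately have "m dvd (D * (x - y)) * (1 + R * (v * k * z))"
    using m by (metis dvd_add dvd_mult)
  then show ?thesis using cop by (simp add: coprime_dvd_mult_left_iff)
qed

text \<open>A Newton correction \<open>h = p ^ (k - e) * t\<close> changes \<open>f x\<close> by
  \<open>p ^ k * t * b\<close> with \<open>b\<close> prime to \<open>p\<close>, up to a quadratic
  error divisible by \<open>p ^ (2 * (k - e))\<close>. As \<open>2 * e < k\<close>, the error
  vanishes modulo \<open>p ^ (k + 1)\<close>, and \<open>h\<close> is divisible by
  \<open>p ^ (e + 1)\<close>, which preserves the valuation of the derivative. The free target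
  \<open>r\<close> serves both to continue the lifting and to stop it.\<close>

lemma hensel_step:
  fixes f :: "int poly" and p x :: int
  assumes p: "prime p" and k: "2 * e < k" "p ^ k dvd poly f x"
    and e: "p ^ e dvd poly (pderiv f) x" "\<not> p ^ Suc e dvd poly (pderiv f) x"
  shows "\<exists>y. [poly f y = p ^ k * r] (mod p ^ Suc k)
     \<and> p ^ e dvd poly (pderiv f) y \<and> \<not> p ^ Suc e dvd poly (pderiv f) y"
proof -
  obtain a where a: "poly f x = p ^ k * a" using k by blast
  obtain b where b: "poly (pderiv f) x = p ^ e * b" using e by blast
  have "\<not> p dvd b" using e(2) p unfolding b by auto
  then have "coprime b p" using p by (metis coprime_commute prime_imp_coprime)
  then obtain b' where b': "[b * b' = 1] (mod p)" using cong_solve_coprime_int by blast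
  \<comment> \<open>This solves \<open>a + t * b = r\<close> modulo \<open>p\<close>.\<close>
  define t where "t = b' * (r - a)"
  define h where "h = p ^ (k - e) * t"
  obtain l where l: "poly f (x + h) = poly f x + h * poly (pderiv f) x + h\<^sup>2 * l"
    using poly_taylor_second_order by blast
  have "h * poly (pderiv f) x = p ^ (k - e) * p ^ e * (t * b)"
    by (simp add: h_def b)
  also have "p ^ (k - e) * p ^ e = p ^ k"
    using k by (simp flip: power_add)
  finally have "h * poly (pderiv f) x = p ^ k * (t * b)" .
  moreover have h2: "p ^ Suc k dvd h\<^sup>2 * l"
  proof -
    have "p ^ Suc k dvd (p ^ (k - e))\<^sup>2"
      unfolding power_mult[symmetric] using k by (intro le_imp_power_dvd) auto
    then show ?thesis by (simp add: h_def power_mult_distrib)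
  qed
  moreover have "[a + t * b = r] (mod p)"
  proof -
    have "a + t * b = a + (b * b') * (r - a)" by (simp add: t_def)
    also have "[\<dots> = a + 1 * (r - a)] (mod p)"
      by (intro cong_add cong_mult b') auto
    finally show ?thesis by simp
  qed
  then have "p ^ Suc k dvd p ^ k * (a + t * b - r)"
    by (simp add: cong_iff_dvd_diff mult_dvd_mono)
  ultimately have "poly f (x + h) - p ^ k * r = p ^ k * (a + t * b - r) + h\<^sup>2 * l"
    "p ^ Suc k dvd p ^ k * (a + t * b - r) + h\<^sup>2 * l"
    by (simp_all add: l a right_diff_distrib distrib_left mult_ac dvd_add del: power_Suc)
  then have 1: "[poly f (x + h) = p ^ k * r] (mod p ^ Suc k)"
    by (simp add: cong_iff_dvd_diff)
  have "p ^ Suc e dvd p ^ (k - e)" using k by (intro le_imp_power_dvd) auto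
  then have "p ^ Suc e dvd h" by (simp add: h_def)
  moreover obtain l' where "poly (pderiv f) (x + h) = poly (pderiv f) x + h * poly (pderiv (pderiv f)) x + h\<^sup>2 * l'"
    using poly_taylor_second_order by blast
  then have "poly (pderiv f) (x + h) = poly (pderiv f) x + h * (poly (pderiv (pderiv f)) x + h * l')"
    by (simp add: algebra_simps power2_eq_square)
  ultimately have c: "[poly (pderiv f) (x + h) = poly (pderiv f) x] (mod p ^ Suc e)"
    by (simp add: cong_iff_dvd_diff)
  then have "[poly (pderiv f) (x + h) = poly (pderiv f) x] (mod p ^ e)"
    by (rule cong_dvd_modulus) simp
  with c 1 e show ?thesis
    by (intro exI[of _ "x + h"]) (simp add: cong_dvd_iff)
qed

text \<open>Hensel steps with target 0 raise the exponent from \<open>g\<close> to \<open>k\<close>;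
  one last step with target 1 makes the value exactly divisible by \<open>p ^ k\<close>. The
  hypothesis on the derivative gives \<open>2 * e < g\<close> for its valuation \<open>e\<close>, so
  every step is allowed.\<close>

lemma exists_exact_prime_power_value:
  fixes f :: "int poly" and p x :: int
  assumes p: "prime p" and fx: "p ^ g dvd poly f x" and f'x: "\<not> p ^ g dvd (poly (pderiv f) x)\<^sup>2"
    and k: "g \<le> k"
  shows "\<exists>y. p ^ k dvd poly f y \<and> \<not> p ^ Suc k dvd poly f y"
proof -
  define e where "e = multiplicity p (poly (pderiv f) x)"
  have nz: "poly (pderiv f) x \<noteq> 0" using f'x by (metis dvd_0_right zero_power2)
  have e: "p ^ e dvd poly (pderiv f) x" "\<not> p ^ Suc e dvd poly (pderiv f) x"
    using power_dvd_iff_le_multiplicity[OF nz, of p] not_prime_unit p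
    unfolding e_def by (blast, metis Suc_n_not_le_n)
  have "p ^ (e * 2) dvd (poly (pderiv f) x)\<^sup>2"
    using e(1) by (simp add: power_mult dvd_power_same)
  with f'x have "\<not> g \<le> e * 2"
    by (meson dvd_trans le_imp_power_dvd)
  then have eg: "2 * e < g" by simp
  have "\<exists>y. p ^ k dvd poly f y \<and> p ^ e dvd poly (pderiv f) y \<and> \<not> p ^ Suc e dvd poly (pderiv f) y"
    using k
  proof (induction k rule: dec_induct)
    case base
    then show ?case using fx e by blast
  next
    case (step k)
    then obtain y where "p ^ k dvd poly f y" "p ^ e dvd poly (pderiv f) y" "\<not> p ^ Suc e dvd poly (pderiv f) y"
      by blast
    from hensel_step[OF p _ this, of 0] eg step show ?case
      by (auto simp: cong_0_iff)
  qed
  then obtain y where "p ^ k dvd poly f y" "p ^ e dvd poly (pderiv f) y" "\<not> p ^ Suc e dvd poly (pderiv f) y"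
    by blast
  from hensel_step[OF p _ this, of 1] eg k
  obtain z where z: "[poly f z = p ^ k] (mod p ^ Suc k)" by auto
  then have "[poly f z = p ^ k] (mod p ^ k)" by (rule cong_dvd_modulus) simp
  then have "p ^ k dvd poly f z" by (simp add: cong_dvd_iff)
  moreover have "\<not> p ^ Suc k dvd poly f z"
    using z p prime_gt_1_int[OF p] by (simp add: cong_dvd_iff)
  ultimately show ?thesis by blast
qed

subsection \<open>Integers composed of a fixed set of primes\<close>

lemma finite_abs_le: "finite {x :: int. \<bar>real_of_int x\<bar> \<le> B}"
proof (rule finite_subset)
  show "{x :: int. \<bar>real_of_int x\<bar> \<le> B} \<subseteq> {-\<lfloor>B\<rfloor>..\<lfloor>B\<rfloor>}"
    by (auto simp: le_floor_iff abs_le_iff)  linarith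
qed simp

text \<open>Cutting the range into half-open cells of length \<open>\<delta>\<close> starting at
  \<open>-B\<close> puts at most one element of \<open>Y\<close> into each cell;
  \<open>\<phi>\<close> is the index of the cell.\<close>

lemma card_separated_le:
  fixes Y :: "int set" and B \<delta> :: real
  assumes "\<delta> > 0" "B \<ge> 0" and Y: "Y \<subseteq> {x. \<bar>real_of_int x\<bar> \<le> B}"
    and sep: "\<And>x y. x \<in> Y \<Longrightarrow> y \<in> Y \<Longrightarrow> x \<noteq> y \<Longrightarrow> \<delta> \<le> \<bar>real_of_int (x - y)\<bar>"
  shows "real (card Y) \<le> 2 * B / \<delta> + 1"
proof -
  define \<phi> where "\<phi> x = nat \<lfloor>(real_of_int x + B) / \<delta>\<rfloor>" for x :: int
  have nn: "0 \<le> (real_of_int x + B) / \<delta>" if "x \<in> Y" for x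
    using that Y assms(1,2) by (intro divide_nonneg_pos) (auto simp: abs_le_iff)
  have "inj_on \<phi> Y"
  proof (rule inj_onI, rule ccontr)
    fix x y assume xy: "x \<in> Y" "y \<in> Y" "\<phi> x = \<phi> y" "x \<noteq> y"
    have "\<lfloor>(real_of_int x + B) / \<delta>\<rfloor> = \<lfloor>(real_of_int y + B) / \<delta>\<rfloor>"
      using xy(3) nn[OF xy(1)] nn[OF xy(2)]
      by (metis \<phi>_def eq_nat_nat_iff zero_le_floor)
    then have "\<bar>(real_of_int x + B) / \<delta> - (real_of_int y + B) / \<delta>\<bar> < 1" by linarith
    then have "\<bar>real_of_int (x - y) / \<delta>\<bar> < 1" by (simp add: diff_divide_distrib[symmetric])
    then have "\<bar>real_of_int (x - y)\<bar> < \<delta>" using assms(1) by (simp add: abs_divide divide_less_eq)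
    then show False using sep[OF xy(1,2,4)] by simp
  qed
  moreover have "\<phi> ` Y \<subseteq> {..nat \<lfloor>2 * B / \<delta>\<rfloor>}"
    using Y assms(1,2) by (auto simp: \<phi>_def abs_le_iff intro!: nat_mono floor_mono divide_right_mono)
  ultimately have "card Y \<le> card {..nat \<lfloor>2 * B / \<delta>\<rfloor>}"
    by (intro card_inj_on_le) auto
  then have "real (card Y) \<le> real (nat \<lfloor>2 * B / \<delta>\<rfloor>) + 1" by simp
  also have "\<dots> \<le> 2 * B / \<delta> + 1"
    using assms by simp
  finally show ?thesis .
qed

text \<open>Every exponent is at most \<open>L\<close> because \<open>m < 2 ^ L\<close>. Once the
  exponents other than that of \<open>q\<close> are fixed, the shell confines the exponent of
  \<open>q\<close> to a window of \<open>K + 1\<close> values, which saves one factor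
  \<open>L + 1\<close>.\<close>

lemma card_smooth_shell_le:
  fixes T :: "nat set" and A :: real and K L q :: nat
  assumes T: "finite T" "q \<in> T" "\<And>p. p \<in> T \<Longrightarrow> 2 \<le> p" and A: "A * real K < 2 ^ L"
  defines "U \<equiv> {m. \<exists>e. m = (\<Prod>p\<in>T. p ^ e p) \<and> A \<le> real m \<and> real m \<le> A * real K}"
  shows "finite U" "card U \<le> (L + 1) ^ (card T - 1) * (K + 1)"
proof -
  define T' where "T' = T - {q}"
  have T0: "p > 0" if "p \<in> T" for p using T(3)[OF that] by simp
  define E where "E = PiE T' (\<lambda>_. {..L})"
  define \<pi> where "\<pi> e = (\<Prod>p\<in>T'. p ^ e p)" for e :: "nat \<Rightarrow> nat"
  define k0 where "k0 m = (LEAST k. A \<le> real (m * q ^ k))" for m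
  have T': "finite T'" "card T' = card T - 1" "T = insert q T'" "q \<notin> T'" using T by (auto simp: T'_def)
  have fE: "finite E" unfolding E_def using T'(1) by (intro finite_PiE) auto
  have sub: "U \<subseteq> (\<Union>e\<in>E. (\<lambda>k. \<pi> e * q ^ k) ` {k0 (\<pi> e)..k0 (\<pi> e) + K})"
  proof
    fix m assume "m \<in> U"
    then obtain e where m: "m = (\<Prod>p\<in>T. p ^ e p)" "A \<le> real m" "real m \<le> A * real K"
      by (auto simp: U_def)
    define e' where "e' = restrict e T'"
    have pi: "\<pi> e' = (\<Prod>p\<in>T'. p ^ e p)" by (auto simp: \<pi>_def e'_def intro!: prod.cong)
    have m': "m = \<pi> e' * q ^ e q"
      unfolding m(1) pi T'(3) using T' by (simp add: mult.commute)
    have Am: "A \<le> real (\<pi> e' * q ^ e q)" using m(2) by (simp only: m')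
    have pos: "m > 0" unfolding m(1) by (intro prod_pos) (auto simp: T0)
    have "real m < 2 ^ L" using m A by linarith
    then have m2: "m < 2 ^ L" by (metis of_nat_less_iff of_nat_numeral of_nat_power)
    have "e p \<le> L" if "p \<in> T" for p
    proof -
      have "p ^ e p dvd m" unfolding m(1) using T that by (intro dvd_prodI)
      then have "p ^ e p \<le> m" using pos by (simp add: dvd_imp_le)
      moreover have "2 ^ e p \<le> p ^ e p" using T that by (intro power_mono) auto
      ultimately have "(2::nat) ^ e p < 2 ^ L" using m2 by linarith
      then show ?thesis by simp
    qed
    then have "e' \<in> E" by (auto simp: E_def e'_def T'_def)
    moreover have le: "k0 (\<pi> e') \<le> e q"
      unfolding k0_def by (rule Least_le[where P = "\<lambda>k. A \<le> real (\<pi> e' * q ^ k)", OF Am])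
    moreover have "e q \<le> k0 (\<pi> e') + K"
    proof -
      define j where "j = e q - k0 (\<pi> e')"
      have "A \<le> real (\<pi> e' * q ^ k0 (\<pi> e'))"
        unfolding k0_def by (rule LeastI[where P = "\<lambda>k. A \<le> real (\<pi> e' * q ^ k)", OF Am])
      then have "A * real (q ^ j) \<le> real (\<pi> e' * q ^ k0 (\<pi> e')) * real (q ^ j)"
        by (intro mult_right_mono) auto
      also have "\<dots> = real m"
        unfolding m' using le by (simp add: j_def mult.assoc flip: power_add)
      also have "\<dots> \<le> A * real K" by (rule m)
      finally have "A * real (q ^ j) \<le> A * real K" .
      moreover have "A > 0"
      proof (rule ccontr)
        assume "\<not> A > 0"
        then have "A * real K \<le> 0" by (simp add: mult_nonpos_nonneg)
        then show False using m(3) pos by simp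
      qed
      ultimately have "q ^ j \<le> K" by simp
      moreover have "j < q ^ j" using T(3)[OF T(2)] by (intro power_gt_expt) auto
      ultimately show ?thesis by (simp add: j_def)
    qed
    ultimately show "m \<in> (\<Union>e\<in>E. (\<lambda>k. \<pi> e * q ^ k) ` {k0 (\<pi> e)..k0 (\<pi> e) + K})"
      unfolding m' by (intro UN_I[of e'] image_eqI[of _ _ "e q"]) auto
  qed
  show "finite U" using fE by (intro finite_subset[OF sub]) auto
  have "card U \<le> card (\<Union>e\<in>E. (\<lambda>k. \<pi> e * q ^ k) ` {k0 (\<pi> e)..k0 (\<pi> e) + K})"
    using fE by (intro card_mono sub) auto
  also have "\<dots> \<le> (\<Sum>e\<in>E. card ((\<lambda>k. \<pi> e * q ^ k) ` {k0 (\<pi> e)..k0 (\<pi> e) + K}))"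
    by (rule card_UN_le[OF fE])
  also have "\<dots> \<le> (\<Sum>e\<in>E. K + 1)"
    by (intro sum_mono order_trans[OF card_image_le]) auto
  also have "\<dots> = (L + 1) ^ (card T - 1) * (K + 1)"
    using T' by (simp add: E_def card_PiE)
  finally show "card U \<le> (L + 1) ^ (card T - 1) * (K + 1)" .
qed

text \<open>The exponents other than that of \<open>q\<close> range freely over
  \<open>{k0..k0 + L}\<close>, and that of \<open>q\<close> is the least one reaching
  \<open>A\<close>, so the overshoot is at most a factor \<open>q\<close>. Were it at most
  \<open>k0\<close>, the product could not exceed the power of \<open>P\<close> in the hypothesis,
  which lies below \<open>A\<close>. The bound \<open>k0\<close> leaves room for exponents that are
  only realised from some point on.\<close>

lemma many_smooth_in_shell:
  fixes T :: "nat set" and A :: real and P L q k0 :: nat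
  assumes T: "finite T" "q \<in> T" "\<And>p. p \<in> T \<Longrightarrow> 2 \<le> p" "\<And>p. p \<in> T \<Longrightarrow> p \<le> P"
    and A: "real P ^ (card T * (k0 + L) + k0) < A"
  shows "\<exists>E \<subseteq> PiE T (\<lambda>_. {k0..}). finite E \<and> card E = (L + 1) ^ (card T - 1) \<and>
    (\<forall>e\<in>E. A \<le> real (\<Prod>p\<in>T. p ^ e p) \<and> real (\<Prod>p\<in>T. p ^ e p) \<le> A * real q)"
proof -
  define T' where "T' = T - {q}"
  have T0: "p > 0" if "p \<in> T" for p using T(3)[OF that] by simp
  define E where "E = PiE T' (\<lambda>_. {k0..k0 + L})"
  define \<pi> where "\<pi> e = (\<Prod>p\<in>T'. p ^ e p)" for e :: "nat \<Rightarrow> nat"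
  define k where "k e = (LEAST k. A \<le> real (\<pi> e * q ^ k))" for e
  define ext where "ext e = e(q := k e)" for e
  have T': "finite T'" "card T' = card T - 1" "T = insert q T'" "q \<notin> T'" using T by (auto simp: T'_def)
  have fE: "finite E" unfolding E_def using T'(1) by (intro finite_PiE) auto
  have q: "2 \<le> q" "q \<le> P" using T by auto
  have A1: "1 \<le> A"
    using A q one_le_power[of "real P" "card T * (k0 + L) + k0"] by linarith
  have prod: "(\<Prod>p\<in>T. p ^ ext e p) = \<pi> e * q ^ k e" for e
  proof -
    have "(\<Prod>p\<in>T'. p ^ ext e p) = \<pi> e"
      unfolding \<pi>_def using T'(4) by (intro prod.cong) (auto simp: ext_def)
    then show ?thesis
      unfolding T'(3) using T'(1,4) by (simp add: ext_def)
  qed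
  have pos: "\<pi> e > 0" for e
    unfolding \<pi>_def T'_def by (intro prod_pos) (auto simp: T0)
  have ex: "\<exists>k. A \<le> real (\<pi> e * q ^ k)" for e
  proof -
    obtain k where "A < real q ^ k" using real_arch_pow[of "real q" A] q by auto
    moreover have "real q ^ k \<le> real (\<pi> e) * real q ^ k"
      using mult_right_mono[of 1 "real (\<pi> e)" "real q ^ k"] pos[of e] by simp
    ultimately have "A \<le> real (\<pi> e * q ^ k)" by simp
    then show ?thesis by blast
  qed
  have lower: "A \<le> real (\<pi> e * q ^ k e)" for e
    unfolding k_def by (rule LeastI_ex[OF ex])
  have ge: "k0 < k e" if "e \<in> E" for e
  proof (rule ccontr)
    assume "\<not> k0 < k e"
    then have "q ^ k e \<le> P ^ k0"
      using q by (intro order_trans[OF power_increasing[of "k e" k0 q] power_mono[of q P k0]]) auto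
    moreover have "\<pi> e \<le> (\<Prod>p\<in>T'. P ^ (k0 + L))"
      unfolding \<pi>_def
    proof (rule prod_mono)
      fix p assume p: "p \<in> T'"
      then have "p \<le> P" "e p \<in> {k0..k0 + L}"
        using T(4) that unfolding E_def T'_def by (blast, blast intro: PiE_mem)
      then have "p ^ e p \<le> P ^ (k0 + L)"
        using q by (intro order_trans[OF power_mono[of p P "e p"] power_increasing[of "e p" "k0 + L" P]]) auto
      then show "0 \<le> p ^ e p \<and> p ^ e p \<le> P ^ (k0 + L)" by simp
    qed
    moreover have "(\<Prod>p\<in>T'. P ^ (k0 + L)) \<le> P ^ (card T * (k0 + L))"
      using q T'(2) by (auto simp flip: power_mult intro!: power_increasing simp: mult.commute)
    ultimately have "\<pi> e * q ^ k e \<le> P ^ (card T * (k0 + L)) * P ^ k0"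
      by (meson le_trans mult_le_mono)
    then have "real (\<pi> e * q ^ k e) \<le> real (P ^ (card T * (k0 + L)) * P ^ k0)"
      by (simp only: of_nat_le_iff)
    also have "\<dots> = real P ^ (card T * (k0 + L) + k0)" by (simp add: power_add)
    finally show False using lower[of e] A by linarith
  qed
  have upper: "real (\<pi> e * q ^ k e) \<le> A * real q" if e: "e \<in> E" for e
  proof -
    obtain j where Suc: "k e = Suc j" using ge[OF e] by (cases "k e") auto
    \<comment> \<open>Minimality of \<open>k e\<close>: one factor \<open>q\<close> fewer stays
      below \<open>A\<close>.\<close>
    have "\<not> A \<le> real (\<pi> e * q ^ j)"
      using not_less_Least[of j "\<lambda>k. A \<le> real (\<pi> e * q ^ k)"] Suc unfolding k_def by simp
    then have "real (\<pi> e * q ^ j) * real q \<le> A * real q" by (intro mult_right_mono) auto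
    then show ?thesis by (simp add: Suc mult_ac)
  qed
  have inj: "inj_on ext E"
  proof (rule inj_onI)
    fix e e' assume e: "e \<in> E" "e' \<in> E" "ext e = ext e'"
    have "e p = e' p" if "p \<in> T'" for p
      using fun_cong[OF e(3), of p] T'(4) that by (auto simp: ext_def split: if_splits)
    with e(1,2) show "e = e'" unfolding E_def by (intro PiE_ext) auto
  qed
  show ?thesis
  proof (intro exI[of _ "ext ` E"] conjI ballI)
    show "ext ` E \<subseteq> PiE T (\<lambda>_. {k0..})"
    proof
      fix e' assume "e' \<in> ext ` E"
      then obtain e where e: "e \<in> E" "e' = e(q := k e)" by (auto simp: ext_def)
      have "e' \<in> PiE (insert q T') (\<lambda>_. {k0..})"
        unfolding e(2) using ge[OF e(1)] e(1)
        by (intro PiE_fun_upd) (auto simp: E_def PiE_iff)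
      then show "e' \<in> PiE T (\<lambda>_. {k0..})" by (simp add: T'(3))
    qed
    show "card (ext ` E) = (L + 1) ^ (card T - 1)"
      unfolding card_image[OF inj] unfolding E_def using T'(1,2) by (simp add: card_PiE)
  qed (use fE lower upper in \<open>auto simp: prod simp del: of_nat_mult of_nat_prod\<close>)
qed

subsection \<open>Size and divisibility of polynomial values\<close>

lemma abs_poly_le:
  fixes f :: "int poly"
  shows "\<exists>C>0. \<forall>x B. 1 \<le> B \<longrightarrow> \<bar>real_of_int x\<bar> \<le> B \<longrightarrow> \<bar>real_of_int (poly f x)\<bar> \<le> C * B ^ degree f"
proof -
  define C where "C = (\<Sum>i\<le>degree f. \<bar>real_of_int (coeff f i)\<bar>) + 1"
  have "\<bar>real_of_int (poly f x)\<bar> \<le> C * B ^ degree f" if "1 \<le> B" "\<bar>real_of_int x\<bar> \<le> B" for x B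
  proof -
    have "\<bar>real_of_int (poly f x)\<bar> = \<bar>\<Sum>i\<le>degree f. real_of_int (coeff f i) * real_of_int x ^ i\<bar>"
      by (simp add: poly_altdef)
    also have "\<dots> \<le> (\<Sum>i\<le>degree f. \<bar>real_of_int (coeff f i)\<bar> * B ^ degree f)"
    proof (intro order_trans[OF sum_abs] sum_mono)
      fix i assume "i \<in> {..degree f}"
      then have "\<bar>real_of_int x\<bar> ^ i \<le> B ^ degree f"
        using that by (intro order_trans[OF power_mono power_increasing]) auto
      then show "\<bar>real_of_int (coeff f i) * real_of_int x ^ i\<bar> \<le> \<bar>real_of_int (coeff f i)\<bar> * B ^ degree f"
        by (simp add: abs_mult power_abs mult_left_mono)
    qed
    also have "\<dots> \<le> C * B ^ degree f"
      using that by (simp add: C_def sum_distrib_right distrib_right)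
    finally show ?thesis .
  qed
  moreover have "C > 0" unfolding C_def by (intro add_nonneg_pos sum_nonneg) auto
  ultimately show ?thesis by blast
qed

text \<open>The lower terms are at most \<open>K * \<bar>x\<bar> ^ (n - 1)\<close>, hence at most
  half of \<open>\<bar>x\<bar> ^ n\<close> once \<open>\<bar>x\<bar> \<ge> 2 * K\<close>; the
  leading coefficient is a non-zero integer.\<close>

lemma abs_poly_ge:
  fixes f :: "int poly"
  assumes "degree f > 0"
  shows "\<exists>X\<ge>1. \<forall>x. X \<le> \<bar>real_of_int x\<bar> \<longrightarrow> \<bar>real_of_int x\<bar> ^ degree f / 2 \<le> \<bar>real_of_int (poly f x)\<bar>"
proof -
  define n where "n = degree f"
  define K where "K = (\<Sum>i<n. \<bar>real_of_int (coeff f i)\<bar>)"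
  have "\<bar>real_of_int x\<bar> ^ n / 2 \<le> \<bar>real_of_int (poly f x)\<bar>" if x: "max 1 (2 * K) \<le> \<bar>real_of_int x\<bar>" for x
  proof -
    let ?r = "\<bar>real_of_int x\<bar>"
    have n: "n = Suc (n - 1)" using assms by (simp add: n_def)
    have "real_of_int (poly f x) = (\<Sum>i<n. real_of_int (coeff f i) * real_of_int x ^ i) + real_of_int (lead_coeff f) * real_of_int x ^ n"
      by (simp add: poly_altdef n_def flip: lessThan_Suc_atMost)
    moreover have "\<bar>\<Sum>i<n. real_of_int (coeff f i) * real_of_int x ^ i\<bar> \<le> ?r ^ n / 2"
    proof -
      have "\<bar>\<Sum>i<n. real_of_int (coeff f i) * real_of_int x ^ i\<bar> \<le> (\<Sum>i<n. \<bar>real_of_int (coeff f i)\<bar> * ?r ^ (n - 1))"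
      proof (intro order_trans[OF sum_abs] sum_mono)
        fix i assume "i \<in> {..<n}"
        then have "?r ^ i \<le> ?r ^ (n - 1)"
          using x by (intro power_increasing) auto
        then show "\<bar>real_of_int (coeff f i) * real_of_int x ^ i\<bar> \<le> \<bar>real_of_int (coeff f i)\<bar> * ?r ^ (n - 1)"
          by (simp add: abs_mult power_abs mult_left_mono)
      qed
      also have "\<dots> = K * ?r ^ (n - 1)" by (simp add: K_def sum_distrib_right)
      also have "\<dots> \<le> (?r / 2) * ?r ^ (n - 1)" using x by (intro mult_right_mono) auto
      also have "\<dots> = ?r ^ n / 2" by (subst (2) n) simp
      finally show ?thesis .
    qed
    moreover have "?r ^ n \<le> \<bar>real_of_int (lead_coeff f) * real_of_int x ^ n\<bar>"
    proof -
      have "lead_coeff f \<noteq> 0" using assms by auto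
      then have "1 \<le> \<bar>real_of_int (lead_coeff f)\<bar>" by linarith
      then have "1 * ?r ^ n \<le> \<bar>real_of_int (lead_coeff f)\<bar> * ?r ^ n" by (intro mult_right_mono) auto
      then show ?thesis by (simp add: abs_mult power_abs)
    qed
    ultimately show ?thesis by linarith
  qed
  then show ?thesis unfolding n_def by (intro exI[of _ "max 1 (2 * K)"]) auto
qed

text \<open>Repeated halving sums the shell contributions as a geometric series of ratio
  \<open>2 powr (- \<theta>)\<close>, so no extra logarithm appears. The induction is on the number
  of halvings needed to come down to \<open>2 * B0\<close>.\<close>

lemma dyadic_recurrence_bound:
  fixes N :: "real \<Rightarrow> real" and k :: nat
  assumes "\<theta> > 0" "C \<ge> 0" and B0: "exp 1 \<le> B0"
    and triv: "\<And>B. B0 \<le> B \<Longrightarrow> N B \<le> 2 * B + 1"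
    and rec: "\<And>B. B0 \<le> B \<Longrightarrow> N B \<le> N (B / 2) + C * B powr \<theta> * ln B ^ k"
  shows "\<exists>C'>0. \<forall>B\<ge>B0. N B \<le> C' * B powr \<theta> * ln B ^ k"
proof -
  define r :: real where "r = 2 powr (- \<theta>)"
  have r: "0 < r" "r < 1" using assms(1) by (auto simp: r_def powr_less_one)
  \<comment> \<open>The first entry covers the base range from \<open>B0\<close> to
    \<open>2 * B0\<close> by the trivial bound; the second gives
    \<open>C' * r + C \<le> C'\<close>.\<close>
  define C' where "C' = max (4 * B0 + 1) (C / (1 - r))"
  have B0': "B0 > 1" using B0 exp_gt_one[of 1] by linarith
  have C': "C' > 0" "4 * B0 + 1 \<le> C'" "C' * r + C \<le> C'"
  proof -
    have "C / (1 - r) \<le> C'" by (simp add: C'_def)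
    then show "C' * r + C \<le> C'" using r by (simp add: field_simps)
  qed (use B0' in \<open>auto simp: C'_def\<close>)
  have ln1: "1 \<le> ln B" if "B0 \<le> B" for B
    using that B0 B0' by (subst ln_ge_iff) auto
  have "N B \<le> C' * B powr \<theta> * ln B ^ k" if "B0 \<le> B" "B \<le> 2 ^ Suc j * B0" for B j
    using that
  proof (induction j arbitrary: B)
    case 0
    have "1 * 1 \<le> B powr \<theta> * ln B ^ k"
      using 0 B0' assms(1) ln1[of B] by (intro mult_mono ge_one_powr_ge_zero one_le_power) auto
    then have "C' * 1 \<le> C' * (B powr \<theta> * ln B ^ k)"
      using C' by (intro mult_left_mono) auto
    moreover have "N B \<le> C'" using triv[of B] 0 C' by simp
    ultimately show ?case by (simp add: mult.assoc)
  next
    case (Suc j)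
    show ?case
    proof (cases "2 * B0 \<le> B")
      case False
      have "2 ^ 1 * B0 \<le> 2 ^ Suc j * B0"
        using B0' by (intro mult_right_mono power_increasing) auto
      then have "B \<le> 2 ^ Suc j * B0" using False by simp
      then show ?thesis using Suc.IH[of B] Suc.prems by simp
    next
      case True
      have "N (B / 2) \<le> C' * (B / 2) powr \<theta> * ln (B / 2) ^ k"
        using Suc.prems True by (intro Suc.IH) auto
      also have "\<dots> \<le> C' * (B / 2) powr \<theta> * ln B ^ k"
        using True B0' C' ln1[of "B / 2"] by (intro mult_left_mono power_mono) auto
      also have "(B / 2) powr \<theta> = r * B powr \<theta>"
        using True B0' by (simp add: powr_divide r_def powr_minus field_simps)
      finally have "N B \<le> (C' * r + C) * (B powr \<theta> * ln B ^ k)"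
        using rec[of B] Suc.prems by (simp add: algebra_simps)
      also have "\<dots> \<le> C' * (B powr \<theta> * ln B ^ k)"
        using C' ln1[of B] Suc.prems by (intro mult_right_mono) auto
      finally show ?thesis by (simp add: mult.assoc)
    qed
  qed
  moreover have "\<exists>j. B \<le> 2 ^ Suc j * B0" if "B0 \<le> B" for B
  proof -
    obtain j where "B < 2 ^ j" using real_arch_pow[of 2 B] by auto
    moreover have "2 ^ j * 1 \<le> 2 ^ Suc j * B0" using B0' by (intro mult_mono) auto
    ultimately have "B \<le> 2 ^ Suc j * B0" by linarith
    then show ?thesis by blast
  qed
  ultimately show ?thesis using C' by blast
qed

text \<open>Within one residue class modulo \<open>\<bar>D\<bar> * R\<close>, distinct solutions
  satisfy \<open>m dvd D * (x - y)\<close> and so lie at least \<open>m / \<bar>D\<bar>\<close>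
  apart. The number of classes does not depend on \<open>m\<close>, which stands in for a uniform
  bound on the number of zeros of \<open>f\<close> modulo \<open>m\<close>.\<close>

lemma card_dvd_poly_le:
  fixes f :: "int poly" and m D R :: int and B :: real
  assumes D: "\<And>y. \<exists>u v. D = u * poly f y + v * poly (pderiv f) y" "D \<noteq> 0"
    and mR: "m > 0" "R > 0" "\<And>w. coprime m (1 + R * w)" and B: "B \<ge> 0"
  shows "real (card {x. \<bar>real_of_int x\<bar> \<le> B \<and> m dvd poly f x})
    \<le> \<bar>D\<bar> * R * (2 * B * \<bar>D\<bar> / m + 1)"
proof -
  define Q where "Q = \<bar>D\<bar> * R"
  define X where "X = {x. \<bar>real_of_int x\<bar> \<le> B \<and> m dvd poly f x}"
  have Q: "Q > 0" using D mR by (simp add: Q_def)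
  have 1: "real (card {x \<in> X. x mod Q = c}) \<le> 2 * B * \<bar>D\<bar> / m + 1" for c
  proof -
    have "real (card {x \<in> X. x mod Q = c}) \<le> 2 * B / (m / \<bar>D\<bar>) + 1"
    proof (rule card_separated_le)
      show "0 < real_of_int m / real_of_int \<bar>D\<bar>" using D mR by simp
      fix x y assume xy: "x \<in> {x \<in> X. x mod Q = c}" "y \<in> {x \<in> X. x mod Q = c}" "x \<noteq> y"
      obtain u v where "D = u * poly f y + v * poly (pderiv f) y" using D by blast
      moreover have "x mod Q = y mod Q" using xy by simp
      then have "Q dvd x - y" by (simp only: mod_eq_dvd_iff)
      then have "D * R dvd x - y" by (simp add: Q_def)
      ultimately have "m dvd D * (x - y)"
        using xy mR by (intro dvd_mult_diff_of_dvd_poly) (auto simp: X_def)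
      moreover have "D * (x - y) \<noteq> 0" using D xy by auto
      ultimately have "m \<le> \<bar>D * (x - y)\<bar>" using dvd_imp_le_int[of "D * (x - y)" m] mR by simp
      then have "real_of_int m \<le> \<bar>real_of_int D\<bar> * \<bar>real_of_int (x - y)\<bar>"
        by (metis abs_mult of_int_abs of_int_le_iff of_int_mult)
      then show "real_of_int m / real_of_int \<bar>D\<bar> \<le> \<bar>real_of_int (x - y)\<bar>"
        using D by (simp add: divide_le_eq mult.commute)
    qed (use B in \<open>auto simp: X_def\<close>)
    then show ?thesis by simp
  qed
  have "X = (\<Union>c\<in>{0..<Q}. {x \<in> X. x mod Q = c})" using Q by auto
  then have "card X \<le> (\<Sum>c\<in>{0..<Q}. card {x \<in> X. x mod Q = c})"
    using card_UN_le[of "{0..<Q}" "\<lambda>c. {x \<in> X. x mod Q = c}"] by simp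
  then have "real (card X) \<le> (\<Sum>c\<in>{0..<Q}. real (card {x \<in> X. x mod Q = c}))"
    unfolding of_nat_sum[symmetric] by (simp only: of_nat_le_iff)
  also have "\<dots> \<le> (\<Sum>c\<in>{0..<Q}. 2 * B * \<bar>D\<bar> / m + 1)"
    by (intro sum_mono 1)
  also have "\<dots> = Q * (2 * B * \<bar>D\<bar> / m + 1)" using Q by simp
  finally show ?thesis by (simp add: X_def Q_def)
qed

section \<open>Divisors composed of the primes of a finite set\<close>

lemma S_part_dvd:
  assumes "finite T" "\<And>p. p \<in> T \<Longrightarrow> prime p"
  shows "int (S_part T m) dvd m"
  using assms
proof (induction T rule: finite_induct)
  case (insert p T)
  have "coprime (int p ^ multiplicity (int p) m) (\<Prod>q\<in>T. int q ^ multiplicity (int q) m)"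
  proof (intro prod_coprime_right)
    fix q assume "q \<in> T"
    then have "coprime p q" using insert by (intro primes_coprime) auto
    then show "coprime (int p ^ multiplicity (int p) m) (int q ^ multiplicity (int q) m)"
      by (simp add: coprime_int_iff)
  qed
  moreover have "(\<Prod>q\<in>T. int q ^ multiplicity (int q) m) dvd m"
    using insert by (simp add: S_part_def)
  ultimately show ?case
    using insert.hyps by (simp add: S_part_def divides_mult multiplicity_dvd)
qed (simp add: S_part_def)

text \<open>Prime factors are removed one at a time while the product exceeds \<open>A * K\<close>;
  each removal divides by at most \<open>K\<close>, so the product cannot drop below
  \<open>A\<close>.\<close>

lemma exists_smooth_divisor_in_shell:
  fixes T :: "nat set" and A :: real and K :: nat
  assumes T: "finite T" "\<And>p. p \<in> T \<Longrightarrow> 0 < p" "\<And>p. p \<in> T \<Longrightarrow> p \<le> K"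
    and A: "1 \<le> A" "1 \<le> K" and "A \<le> real (\<Prod>p\<in>T. p ^ e p)"
  shows "\<exists>e'. (\<Prod>p\<in>T. p ^ e' p) dvd (\<Prod>p\<in>T. p ^ e p) \<and>
    A \<le> real (\<Prod>p\<in>T. p ^ e' p) \<and> real (\<Prod>p\<in>T. p ^ e' p) \<le> A * real K"
  using assms(6)
proof (induction "\<Sum>p\<in>T. e p" arbitrary: e rule: less_induct)
  case less
  define M where "M = (\<Prod>p\<in>T. p ^ e p)"
  show ?case
  proof (cases "real M \<le> A * real K")
    case True
    then show ?thesis using less.prems unfolding M_def by (intro exI[of _ e] conjI dvd_refl)
  next
    case False
    have "1 * 1 \<le> A * real K" using A by (intro mult_mono) auto
    then have "M \<noteq> 1" using False by auto
    then obtain q where q: "q \<in> T" "e q > 0"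
      unfolding M_def by (metis (no_types, lifting) gr0I power_0 prod.neutral)
    define e' where "e' = e(q := e q - 1)"
    have eq: "M = q * (\<Prod>p\<in>T. p ^ e' p)"
    proof -
      have "(\<Prod>p\<in>T - {q}. p ^ e' p) = (\<Prod>p\<in>T - {q}. p ^ e p)"
        by (intro prod.cong) (auto simp: e'_def)
      moreover have "q ^ e q = q * q ^ e' q" using q by (simp add: e'_def flip: power_Suc)
      ultimately show ?thesis
        unfolding M_def using T(1) q(1) by (simp add: prod.remove[of T q] mult.assoc)
    qed
    have "A * real K < real q * real (\<Prod>p\<in>T. p ^ e' p)"
      using False unfolding eq by simp
    also have "\<dots> \<le> real K * real (\<Prod>p\<in>T. p ^ e' p)"
      using T(3)[OF q(1)] by (intro mult_right_mono of_nat_0_le_iff) simp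
    finally have "A \<le> real (\<Prod>p\<in>T. p ^ e' p)" using A by simp
    moreover have "(\<Sum>p\<in>T. e' p) < (\<Sum>p\<in>T. e p)"
      using T(1) q by (intro sum_strict_mono_ex1) (auto simp: e'_def)
    ultimately obtain e'' where
      "(\<Prod>p\<in>T. p ^ e'' p) dvd (\<Prod>p\<in>T. p ^ e' p)"
      "A \<le> real (\<Prod>p\<in>T. p ^ e'' p)" "real (\<Prod>p\<in>T. p ^ e'' p) \<le> A * real K"
      using less.hyps by blast
    then show ?thesis unfolding M_def[symmetric] eq by (intro exI[of _ e'']) auto
  qed
qed

text \<open>Each prime of \<open>T\<close> divides \<open>\<Prod>T\<close>, so the right side is 1
  modulo it. This provides the coprimality required by \<open>card_dvd_poly_le\<close> with
  \<open>R\<close> the product of \<open>T\<close>.\<close>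

lemma coprime_smooth_one_plus:
  fixes T :: "nat set"
  assumes "finite T"
  shows "coprime (int (\<Prod>p\<in>T. p ^ e p)) (1 + int (\<Prod>T) * w)"
proof -
  have "coprime (int p ^ e p) (1 + int (\<Prod>T) * w)" if "p \<in> T" for p
  proof -
    have "p dvd \<Prod>T" using dvd_prodI[OF assms that, of "\<lambda>x. x"] by simp
    then obtain z where "\<Prod>T = p * z" by blast
    then have "1 + int (\<Prod>T) * w = 1 + int p * (int z * w)" by simp
    moreover have "coprime (int p) (1 + int p * (int z * w))"
      by (metis add.commute coprime_1_right coprime_iff_gcd_eq_1 gcd_add_mult mult.commute)
    ultimately show ?thesis by (simp only: coprime_power_left_iff simp_thms)
  qed
  then show ?thesis by (simp only: of_nat_prod of_nat_power) (intro prod_coprime_left, auto)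
qed

lemma S_part_le_mult:
  assumes "finite S" "T \<subseteq> S" "\<And>p. p \<in> S \<Longrightarrow> p > 0"
    and "\<And>p. p \<in> S - T \<Longrightarrow> multiplicity (int p) m \<le> g p"
  shows "S_part S m \<le> S_part T m * (\<Prod>p\<in>S - T. p ^ g p)"
proof -
  have "S_part S m = S_part T m * (\<Prod>p\<in>S - T. p ^ multiplicity (int p) m)"
    unfolding S_part_def using assms by (simp add: prod.subset_diff mult.commute)
  also have "(\<Prod>p\<in>S - T. p ^ multiplicity (int p) m) \<le> (\<Prod>p\<in>S - T. p ^ g p)"
    using assms by (intro prod_mono) (auto intro!: power_increasing simp: Suc_le_eq)
  finally show ?thesis by simp
qed

subsection \<open>The upper bound\<close>

text \<open>The points gained on passing from \<open>B / 2\<close> to \<open>B\<close> are covered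
  by the sets \<open>V m\<close> with \<open>m\<close> in a shell at \<open>A B\<close>. Bounding
  the number of such \<open>m\<close> and the size of each \<open>V m\<close> yields the recurrence
  for \<open>dyadic_recurrence_bound\<close>.\<close>

lemma count_large_S_part_upper:
  fixes f :: "int poly" and \<epsilon> :: real and S T :: "nat set" and g :: "nat \<Rightarrow> nat" and D :: int
  defines "n \<equiv> degree f" and "\<theta> \<equiv> 1 - real (degree f) * \<epsilon>"
  assumes n: "n > 0" and \<epsilon>: "0 < \<epsilon>" "\<epsilon> < 1 / real n"
    and D: "\<And>y. \<exists>u v. D = u * poly f y + v * poly (pderiv f) y" "D \<noteq> 0"
    and S: "finite S" "\<And>p. p \<in> S \<Longrightarrow> prime p" and T: "T \<subseteq> S" "T \<noteq> {}"
    and nonT: "\<And>p x. p \<in> S - T \<Longrightarrow> \<not> int p ^ (g p + 1) dvd poly f x"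
  shows "\<exists>C>0. \<forall>\<^sub>F B in at_top.
    real (count_large_S_part f S \<epsilon> B) \<le> C * B powr \<theta> * ln B ^ (card T - 1)"
proof -
  define a where "a = real n * \<epsilon>"
  have a: "0 < a" "a < 1" "\<theta> = 1 - a"
    using n \<epsilon> by (auto simp: a_def \<theta>_def n_def field_simps)
  have finT: "finite T" using S T finite_subset by blast
  have Tpr: "prime p" if "p \<in> T" for p using that S T by blast
  obtain q where q: "q \<in> T" using T by blast
  obtain X where X: "X \<ge> 1" "\<And>x. X \<le> \<bar>real_of_int x\<bar> \<Longrightarrow> \<bar>real_of_int x\<bar> ^ n / 2 \<le> \<bar>real_of_int (poly f x)\<bar>"
    using abs_poly_ge[of f] n unfolding n_def by blast
  define G where "G = (\<Prod>p\<in>S - T. p ^ g p)"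
  have G: "G > 0" unfolding G_def using S(2) by (intro prod_pos) (auto simp: prime_gt_0_nat)
  \<comment> \<open>Comes from \<open>\<bar>f x\<bar> \<ge> (B / 2) ^ n / 2\<close>, after division
    by the bound \<open>G\<close> for the part of \<open>f x\<close> outside
    \<open>T\<close>.\<close>
  define c where "c = ((1 / 2) ^ n / 2) powr \<epsilon> / real G"
  have c: "c > 0" using G by (simp add: c_def)
  define K where "K = Max T"
  have K: "p \<le> K" if "p \<in> T" for p using that finT by (simp add: K_def)
  have K1: "1 \<le> K" using K[OF q] prime_gt_0_nat[OF Tpr[OF q]] by simp
  define R where "R = int (\<Prod>T)"
  have R: "R > 0" unfolding R_def using Tpr by (simp only: of_nat_0_less_iff) (intro prod_pos, auto simp: prime_gt_0_nat)
  define A where "A B = c * B powr a" for B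
  \<comment> \<open>Ensures \<open>2 ^ L B > B powr 2\<close>, which exceeds the top
    \<open>A B * K\<close> of the shell for large \<open>B\<close>.\<close>
  define L where "L B = nat \<lfloor>2 * log 2 B\<rfloor> + 1" for B :: real
  define W where "W = \<bar>D\<bar> * R * (2 * \<bar>D\<bar> / c + 1)"
  have W: "W > 0" unfolding W_def using D(2) R c by (intro mult_pos_pos add_nonneg_pos) auto
  define X_set where "X_set B = {x :: int. \<bar>real_of_int x\<bar> \<le> B \<and> poly f x \<noteq> 0 \<and>
       real (S_part S (poly f x)) \<ge> real_of_int \<bar>poly f x\<bar> powr \<epsilon>}" for B
  have count: "count_large_S_part f S \<epsilon> B = card (X_set B)" for B
    by (simp add: count_large_S_part_def X_set_def)
  have fin: "finite (X_set B)" for B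
    by (rule finite_subset[OF _ finite_abs_le[of B]]) (auto simp: X_set_def)

  have large: "A B \<le> real (S_part T (poly f x))"
    if B: "1 \<le> B" "2 * X \<le> B" and x: "x \<in> X_set B" "x \<notin> X_set (B / 2)" for B x
  proof -
    \<comment> \<open>Membership in \<open>X_set\<close> depends on the bound only through the size
      of \<open>x\<close>.\<close>
    have xB: "B / 2 < \<bar>real_of_int x\<bar>" using x by (auto simp: X_set_def)
    have "(B / 2) ^ n / 2 \<le> \<bar>real_of_int x\<bar> ^ n / 2"
      using xB B by (intro divide_right_mono power_mono) auto
    also have "\<dots> \<le> \<bar>real_of_int (poly f x)\<bar>" using X(2)[of x] xB B by simp
    finally have "((B / 2) ^ n / 2) powr \<epsilon> \<le> real_of_int \<bar>poly f x\<bar> powr \<epsilon>"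
      using B \<epsilon> by (intro powr_mono2) auto
    also have "\<dots> \<le> real (S_part S (poly f x))" using x by (simp add: X_set_def)
    also have "\<dots> \<le> real (S_part T (poly f x) * G)"
    proof -
      have "multiplicity (int p) (poly f x) \<le> g p" if "p \<in> S - T" for p
      proof -
        have "\<not> is_unit (int p)" using S(2)[of p] that by auto
        moreover have "poly f x \<noteq> 0" using x by (simp add: X_set_def)
        ultimately have "multiplicity (int p) (poly f x) < g p + 1"
          using nonT[OF that] by (intro multiplicity_lessI)
        then show ?thesis by simp
      qed
      then show ?thesis unfolding G_def of_nat_le_iff
        using S T by (intro S_part_le_mult) (auto simp: prime_gt_0_nat)
    qed
    finally have 1: "((B / 2) ^ n / 2) powr \<epsilon> / real G \<le> real (S_part T (poly f x))"
      using G by (simp add: divide_le_eq)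
    have "((B / 2) ^ n / 2) powr \<epsilon> = ((1 / 2) ^ n / 2 * B ^ n) powr \<epsilon>"
      by (simp add: power_divide)
    also have "\<dots> = ((1 / 2) ^ n / 2) powr \<epsilon> * (B ^ n) powr \<epsilon>"
      using B by (intro powr_mult)
    also have "(B ^ n) powr \<epsilon> = B powr a"
      using B by (simp add: a_def powr_powr flip: powr_realpow)
    finally show ?thesis using 1 by (simp add: A_def c_def)
  qed

  have shell: "real (card (X_set B)) \<le> real (card (X_set (B / 2)))
      + (real (L B) + 1) ^ (card T - 1) * (real K + 1) * (W * B powr \<theta>)"
    if B: "1 \<le> B" "2 * X \<le> B" "1 \<le> A B" "A B * real K < 2 ^ L B" for B
  proof -
    define U where "U = {m. \<exists>e. m = (\<Prod>p\<in>T. p ^ e p) \<and> A B \<le> real m \<and> real m \<le> A B * real K}"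
    define V where "V m = {x. \<bar>real_of_int x\<bar> \<le> B \<and> int m dvd poly f x}" for m
    have U: "finite U" "card U \<le> (L B + 1) ^ (card T - 1) * (K + 1)"
      unfolding U_def by (rule card_smooth_shell_le[OF finT q prime_ge_2_nat[OF Tpr] B(4)], assumption)+
    have "X_set B \<subseteq> X_set (B / 2) \<union> (\<Union>m\<in>U. V m)"
    proof
      fix x assume x: "x \<in> X_set B"
      show "x \<in> X_set (B / 2) \<union> (\<Union>m\<in>U. V m)"
      proof (cases "x \<in> X_set (B / 2)")
        case False
        let ?e = "\<lambda>p. multiplicity (int p) (poly f x)"
        have "A B \<le> real (\<Prod>p\<in>T. p ^ ?e p)"
          using large[OF B(1,2) x False] by (simp only: S_part_def)
        from exists_smooth_divisor_in_shell[OF finT _ K B(3) K1 this]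
        obtain e' where e': "(\<Prod>p\<in>T. p ^ e' p) dvd (\<Prod>p\<in>T. p ^ ?e p)"
          "A B \<le> real (\<Prod>p\<in>T. p ^ e' p)" "real (\<Prod>p\<in>T. p ^ e' p) \<le> A B * real K"
          using Tpr prime_gt_0_nat by blast
        have "int (\<Prod>p\<in>T. p ^ e' p) dvd int (S_part T (poly f x))"
          unfolding S_part_def using e'(1) by (simp only: int_dvd_int_iff)
        also have "int (S_part T (poly f x)) dvd poly f x"
          by (rule S_part_dvd[OF finT Tpr])
        finally have "x \<in> V (\<Prod>p\<in>T. p ^ e' p)" using x by (simp only: V_def X_set_def) simp
        moreover have "(\<Prod>p\<in>T. p ^ e' p) \<in> U" unfolding U_def using e'(2,3) by blast
        ultimately show ?thesis by blast
      qed simp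
    qed
    moreover have finV: "finite (V m)" for m
      by (rule finite_subset[OF _ finite_abs_le[of B]]) (auto simp: V_def)
    ultimately have "card (X_set B) \<le> card (X_set (B / 2) \<union> (\<Union>m\<in>U. V m))"
      using U(1) fin by (intro card_mono) auto
    also have "\<dots> \<le> card (X_set (B / 2)) + (\<Sum>m\<in>U. card (V m))"
      using card_Un_le card_UN_le[OF U(1), of V] by (meson add_left_mono le_trans)
    finally have "real (card (X_set B)) \<le> real (card (X_set (B / 2)) + (\<Sum>m\<in>U. card (V m)))"
      by (simp only: of_nat_le_iff)
    also have "\<dots> = real (card (X_set (B / 2))) + (\<Sum>m\<in>U. real (card (V m)))"
      by simp
    also have "(\<Sum>m\<in>U. real (card (V m))) \<le> (\<Sum>m\<in>U. W * B powr \<theta>)"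
    proof (rule sum_mono)
      fix m assume "m \<in> U"
      then obtain e where m: "m = (\<Prod>p\<in>T. p ^ e p)" "A B \<le> real m" by (auto simp: U_def)
      have "coprime (int m) (1 + R * w)" for w
        unfolding m(1) R_def by (rule coprime_smooth_one_plus[OF finT])
      moreover have m0: "0 < real m" using m(2) B(3) by linarith
      ultimately have "real (card (V m)) \<le> \<bar>D\<bar> * R * (2 * B * \<bar>D\<bar> / int m + 1)"
        unfolding V_def using D R B(1) by (intro card_dvd_poly_le) auto
      also have "\<dots> \<le> \<bar>D\<bar> * R * ((2 * \<bar>D\<bar> / c + 1) * B powr \<theta>)"
      proof (intro mult_left_mono)
        have "2 * B * \<bar>D\<bar> / int m \<le> 2 * B * \<bar>D\<bar> / A B"
          using m B m0 by (intro divide_left_mono) auto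
        also have "\<dots> = 2 * \<bar>D\<bar> / c * B powr \<theta>"
          using B c by (simp add: A_def a(3) powr_diff)
        finally have "2 * B * \<bar>D\<bar> / int m \<le> 2 * \<bar>D\<bar> / c * B powr \<theta>" .
        \<comment> \<open>Absorbs the summand 1 of the count; this rests on
          \<open>a < 1\<close>.\<close>
        moreover have "1 \<le> B powr \<theta>" using B a by (intro ge_one_powr_ge_zero) auto
        ultimately show "2 * B * \<bar>D\<bar> / int m + 1 \<le> (2 * \<bar>D\<bar> / c + 1) * B powr \<theta>"
          by (simp add: distrib_right)
      qed (use R in auto)
      also have "\<dots> = W * B powr \<theta>" by (simp add: W_def)
      finally show "real (card (V m)) \<le> W * B powr \<theta>" .
    qed
    also have "\<dots> = real (card U) * (W * B powr \<theta>)" by simp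
    also have "\<dots> \<le> real ((L B + 1) ^ (card T - 1) * (K + 1)) * (W * B powr \<theta>)"
      using W U(2) by (intro mult_right_mono) (simp_all only: of_nat_le_iff, simp)
    finally show ?thesis by (simp only: of_nat_mult of_nat_power of_nat_add of_nat_1)
  qed

  \<comment> \<open>Chosen so that \<open>2 * log 2 B + 2 \<le> W2 * ln B\<close> once
    \<open>ln B \<ge> 1\<close>.\<close>
  define W2 :: real where "W2 = 2 / ln 2 + 2"
  have "\<forall>\<^sub>F B in at_top. 1 \<le> c * B powr a" using c a by real_asymp
  moreover have "\<forall>\<^sub>F B in at_top. exp 1 \<le> B \<and> 2 * X \<le> B \<and> c * real K \<le> B"
    by (intro eventually_conj eventually_ge_at_top)
  ultimately have "\<forall>\<^sub>F B in at_top. 1 \<le> A B \<and> exp 1 \<le> B \<and> 2 * X \<le> B \<and> c * real K \<le> B"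
    unfolding A_def by (rule eventually_conj)
  then obtain B0 where B0: "\<And>B. B0 \<le> B \<Longrightarrow> 1 \<le> A B \<and> exp 1 \<le> B \<and> 2 * X \<le> B \<and> c * real K \<le> B"
    unfolding eventually_at_top_linorder by blast
  have rec: "real (card (X_set B)) \<le> real (card (X_set (B / 2)))
      + (W2 ^ (card T - 1) * (real K + 1) * W) * B powr \<theta> * ln B ^ (card T - 1)" if "B0 \<le> B" for B
  proof -
    have B: "1 \<le> A B" "exp 1 \<le> B" "2 * X \<le> B" "c * real K \<le> B" using B0[OF that] by auto
    have B1: "1 < B" using B(2) exp_gt_one[of 1] by linarith
    have lnB: "1 \<le> ln B" using B B1 by (subst ln_ge_iff) auto
    have lg: "0 \<le> log 2 B" using B1 by simp
    have "A B * real K < 2 ^ L B"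
    proof -
      have "A B * real K = (c * real K) * B powr a" by (simp add: A_def)
      also have "\<dots> \<le> B * B powr 1"
        using B B1 a by (intro mult_mono powr_mono) auto
      also have "\<dots> = B powr 2" using B1 by (simp add: power2_eq_square)
      also have "\<dots> = (2 powr log 2 B) powr 2" using B1 by simp
      also have "\<dots> = 2 powr (2 * log 2 B)" by (simp only: powr_powr mult.commute)
      also have "\<dots> < 2 powr real (L B)"
        using lg by (intro powr_less_mono) (auto simp: L_def, linarith)
      also have "\<dots> = 2 ^ L B" by (simp add: powr_realpow)
      finally show ?thesis .
    qed
    then have "real (card (X_set B)) \<le> real (card (X_set (B / 2)))
      + (real (L B) + 1) ^ (card T - 1) * (real K + 1) * (W * B powr \<theta>)"
      using B B1 by (intro shell) auto
    also have "(real (L B) + 1) ^ (card T - 1) * (real K + 1) * (W * B powr \<theta>)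
      \<le> (W2 * ln B) ^ (card T - 1) * (real K + 1) * (W * B powr \<theta>)"
    proof (intro mult_right_mono power_mono)
      have "real (L B) \<le> 2 * log 2 B + 1" using lg by (simp add: L_def)
      also have "\<dots> = 2 / ln 2 * ln B + 1" by (simp add: log_def)
      finally show "real (L B) + 1 \<le> W2 * ln B"
        using lnB by (simp add: W2_def distrib_right)
    qed (use W in auto)
    finally show ?thesis by (simp add: power_mult_distrib mult_ac)
  qed
  have "\<exists>C'>0. \<forall>B\<ge>max (exp 1) B0. real (card (X_set B)) \<le> C' * B powr \<theta> * ln B ^ (card T - 1)"
  proof (rule dyadic_recurrence_bound)
    show "\<theta> > 0" using a by simp
    show "0 \<le> W2 ^ (card T - 1) * (real K + 1) * W" using W by (simp add: W2_def)
    fix B assume "max (exp 1) B0 \<le> B"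
    then show "real (card (X_set B)) \<le> real (card (X_set (B / 2)))
      + (W2 ^ (card T - 1) * (real K + 1) * W) * B powr \<theta> * ln B ^ (card T - 1)"
      by (intro rec) auto
    have "exp 1 \<le> B" using \<open>max (exp 1) B0 \<le> B\<close> by simp
    then have "0 \<le> B" using exp_ge_zero order_trans by blast
    \<comment> \<open>The trivial bound: distinct integers are at least 1 apart.\<close>
    then have "real (card (X_set B)) \<le> 2 * B / 1 + 1"
      by (intro card_separated_le) (auto simp: X_set_def)
    then show "real (card (X_set B)) \<le> 2 * B + 1" by simp
  qed simp
  then show ?thesis unfolding count eventually_at_top_linorder by blast
qed

subsection \<open>The lower bound\<close>

lemma cong_poly:
  fixes f :: "int poly"
  assumes "[x = y] (mod m)"
  shows "[poly f x = poly f y] (mod m)"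
proof -
  obtain k where "poly f (y + (x - y)) = poly f y + (x - y) * poly (pderiv f) y + (x - y)\<^sup>2 * k"
    using poly_taylor_second_order by blast
  then have "poly f x - poly f y = (x - y) * (poly (pderiv f) y + (x - y) * k)"
    by (simp add: algebra_simps power2_eq_square)
  then show ?thesis using assms by (simp add: cong_iff_dvd_diff)
qed

text \<open>The class has at least the floor of \<open>B / Q\<close> members between 0 and
  \<open>B\<close>, and this floor is at least half of \<open>B / Q\<close> because
  \<open>B / Q \<ge> 1\<close>.\<close>

lemma card_residue_class_ge:
  fixes Q z :: int and B :: real
  assumes Q: "0 < Q" "real_of_int Q \<le> B"
  shows "B / (2 * Q) \<le> real (card {x. \<bar>real_of_int x\<bar> \<le> B \<and> [x = z] (mod Q)})"
proof -
  define \<phi> where "\<phi> j = z mod Q + Q * int j" for j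
  define J where "J = nat \<lfloor>B / Q\<rfloor>"
  have BQ: "1 \<le> B / Q" using Q by simp
  have "\<phi> ` {..<J} \<subseteq> {x. \<bar>real_of_int x\<bar> \<le> B \<and> [x = z] (mod Q)}"
  proof safe
    fix j assume "j < J"
    have z: "0 \<le> z mod Q" "z mod Q < Q" using Q by auto
    have nonneg: "\<phi> j \<ge> 0" using z Q by (simp add: \<phi>_def)
    have "\<phi> j \<le> Q * (int j + 1)" using z by (simp add: \<phi>_def distrib_left)
    then have "real_of_int (\<phi> j) \<le> real_of_int (Q * (int j + 1))" by (simp only: of_int_le_iff)
    also have "\<dots> = real_of_int Q * (real j + 1)" by simp
    also have "\<dots> \<le> real_of_int Q * (B / Q)"
    proof (intro mult_left_mono)
      have "int j + 1 \<le> \<lfloor>B / Q\<rfloor>" using \<open>j < J\<close> by (simp add: J_def)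
      then have "of_int (int j + 1) \<le> B / Q" by (simp only: le_floor_iff)
      then show "real j + 1 \<le> B / Q" by simp
    qed (use Q in auto)
    also have "\<dots> = B" using Q by simp
    finally show "\<bar>real_of_int (\<phi> j)\<bar> \<le> B" using nonneg by simp
    show "[\<phi> j = z] (mod Q)" unfolding \<phi>_def unique_euclidean_semiring_class.cong_def by simp
  qed
  moreover have "finite {x. \<bar>real_of_int x\<bar> \<le> B \<and> [x = z] (mod Q)}"
    by (rule finite_subset[OF _ finite_abs_le[of B]]) auto
  moreover have "inj_on \<phi> {..<J}" using Q by (auto simp: \<phi>_def inj_on_def)
  ultimately have "card {..<J} \<le> card {x. \<bar>real_of_int x\<bar> \<le> B \<and> [x = z] (mod Q)}"
    by (metis card_image card_mono)
  moreover have "B / (2 * Q) \<le> real J"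
  proof -
    have "y / 2 \<le> real_of_int \<lfloor>y\<rfloor>" if "1 \<le> y" for y :: real
    proof -
      have "1 \<le> \<lfloor>y\<rfloor>" using that by simp
      then have "real_of_int 1 \<le> real_of_int \<lfloor>y\<rfloor>" by (simp only: of_int_le_iff)
      moreover have "y - 1 < real_of_int \<lfloor>y\<rfloor>" by linarith
      ultimately show ?thesis by linarith
    qed
    from this[OF BQ] show ?thesis using BQ by (simp add: J_def field_simps)
  qed
  ultimately show ?thesis by simp
qed

lemma chinese_remainder_prime_powers:
  fixes T :: "nat set" and r :: "nat \<Rightarrow> int" and e :: "nat \<Rightarrow> nat"
  assumes "finite T" "\<And>p. p \<in> T \<Longrightarrow> prime p"
  shows "\<exists>z. \<forall>p\<in>T. [z = r p] (mod int p ^ e p)"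
proof -
  have "\<exists>x. \<forall>p\<in>T. [x = nat (r p mod int (p ^ e p))] (mod p ^ e p)"
    using assms by (intro chinese_remainder_nat) (auto intro: primes_coprime)
  then obtain x where x: "\<And>p. p \<in> T \<Longrightarrow> [x = nat (r p mod int (p ^ e p))] (mod p ^ e p)" by blast
  have "[int x = r p] (mod int p ^ e p)" if "p \<in> T" for p
  proof -
    have "int (p ^ e p) > 0" using assms(2)[OF that] prime_gt_0_nat by simp
    then have "int (nat (r p mod int (p ^ e p))) = r p mod int (p ^ e p)" by simp
    moreover have "[int x = int (nat (r p mod int (p ^ e p)))] (mod int (p ^ e p))"
      using x[OF that] by (simp only: cong_int_iff)
    ultimately show ?thesis by (simp add: unique_euclidean_semiring_class.cong_def)
  qed
  then show ?thesis by blast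
qed

text \<open>Prescribing \<open>x\<close> modulo \<open>p ^ (e p + 1)\<close> for all
  \<open>p\<close> in \<open>T\<close> makes the valuations of \<open>f x\<close> exactly
  \<open>e p\<close>. Hence different exponent tuples give disjoint classes \<open>Y e\<close>, and
  the count is a sum over tuples.\<close>

lemma count_large_S_part_lower:
  fixes f :: "int poly" and \<epsilon> :: real and S T :: "nat set"
  defines "n \<equiv> degree f" and "\<theta> \<equiv> 1 - real (degree f) * \<epsilon>"
  assumes n: "n > 0" and \<epsilon>: "0 < \<epsilon>" "\<epsilon> < 1 / real n"
    and S: "finite S" "\<And>p. p \<in> S \<Longrightarrow> prime p" and T: "T \<subseteq> S" "T \<noteq> {}"
    and exact: "\<And>p. p \<in> T \<Longrightarrow> \<exists>k0. \<forall>k\<ge>k0. \<exists>x. int p ^ k dvd poly f x \<and> \<not> int p ^ Suc k dvd poly f x"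
  shows "\<exists>c>0. \<forall>\<^sub>F B in at_top.
    c * B powr \<theta> * ln B ^ (card T - 1) \<le> real (count_large_S_part f S \<epsilon> B)"
proof -
  define a where "a = real n * \<epsilon>"
  have a: "0 < a" "a < 1" "\<theta> = 1 - a"
    using n \<epsilon> by (auto simp: a_def \<theta>_def n_def field_simps)
  have finT: "finite T" using S T finite_subset by blast
  have Tpr: "prime p" if "p \<in> T" for p using that S T by blast
  obtain q where q: "q \<in> T" using T by blast
  obtain C1 where C1: "C1 > 0" "\<And>x B. 1 \<le> B \<Longrightarrow> \<bar>real_of_int x\<bar> \<le> B \<Longrightarrow> \<bar>real_of_int (poly f x)\<bar> \<le> C1 * B ^ n"
    using abs_poly_le[of f] unfolding n_def by blast
  obtain \<kappa> where \<kappa>: "\<And>p k. p \<in> T \<Longrightarrow> \<kappa> p \<le> k \<Longrightarrow> \<exists>x. int p ^ k dvd poly f x \<and> \<not> int p ^ Suc k dvd poly f x"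
    using exact by metis
  define k0 where "k0 = Max (\<kappa> ` T)"
  have "\<exists>x. int p ^ k dvd poly f x \<and> \<not> int p ^ Suc k dvd poly f x" if "p \<in> T" "k0 \<le> k" for p k
  proof (rule \<kappa>[OF that(1)])
    have "\<kappa> p \<le> k0" unfolding k0_def using finT that by (intro Max_ge) auto
    then show "\<kappa> p \<le> k" using that by simp
  qed
  then obtain r where r: "\<And>p k. p \<in> T \<Longrightarrow> k0 \<le> k \<Longrightarrow> int p ^ k dvd poly f (r p k) \<and> \<not> int p ^ Suc k dvd poly f (r p k)"
    by metis
  define s where "s = card T"
  have s: "s > 0" using finT T by (auto simp: s_def card_gt_0_iff)
  define P where "P = Max T"
  have P: "p \<le> P" if "p \<in> T" for p using that finT by (simp add: P_def)
  have P2: "2 \<le> P" using P[OF q] prime_ge_2_nat[OF Tpr[OF q]] by simp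
  define rad where "rad = \<Prod>T"
  have rad: "rad > 0" unfolding rad_def using Tpr by (intro prod_pos) (auto simp: prime_gt_0_nat)
  \<comment> \<open>Since \<open>\<bar>f x\<bar> powr \<epsilon> \<le> c1 * B powr a\<close>, a
    \<open>T\<close>-part of at least \<open>A B\<close> suffices.\<close>
  define c1 where "c1 = C1 powr \<epsilon>"
  have c1: "c1 > 0" using C1 by (simp add: c1_def)
  define A where "A B = c1 * B powr a" for B
  \<comment> \<open>Makes \<open>P ^ (s * L B)\<close> at most \<open>B powr (a / 2)\<close>, which
    \<open>A B\<close> eventually beats by any constant factor.\<close>
  define \<eta> where "\<eta> = a / (2 * real s * ln (real P))"
  have \<eta>: "\<eta> > 0" using a s P2 by (simp add: \<eta>_def)
  define L where "L B = nat \<lfloor>\<eta> * ln B\<rfloor>" for B :: real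
  \<comment> \<open>The modulus \<open>Q e\<close> is at most \<open>A B * b\<close>:
    \<open>q\<close> pays for the overshoot of the shell, \<open>rad\<close> for the extra power of
    each prime.\<close>
  define b where "b = real q * real rad"
  have b: "b > 0" using rad prime_gt_0_nat[OF Tpr[OF q]] by (simp add: b_def)
  define X_set where "X_set B = {x :: int. \<bar>real_of_int x\<bar> \<le> B \<and> poly f x \<noteq> 0 \<and>
       real (S_part S (poly f x)) \<ge> real_of_int \<bar>poly f x\<bar> powr \<epsilon>}" for B
  have count: "count_large_S_part f S \<epsilon> B = card (X_set B)" for B
    by (simp add: count_large_S_part_def X_set_def)
  have fin: "finite (X_set B)" for B
    by (rule finite_subset[OF _ finite_abs_le[of B]]) (auto simp: X_set_def)

  have main: "(real (L B) + 1) ^ (s - 1) * (B powr \<theta> / (2 * c1 * b)) \<le> real (card (X_set B))"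
    if B: "1 \<le> B" "real P ^ (s * (k0 + L B) + k0) < A B" "A B * b \<le> B" for B
  proof -
    obtain E where E: "E \<subseteq> PiE T (\<lambda>_. {k0..})" "finite E" "card E = (L B + 1) ^ (s - 1)"
      "\<And>e. e \<in> E \<Longrightarrow> A B \<le> real (\<Prod>p\<in>T. p ^ e p)"
      "\<And>e. e \<in> E \<Longrightarrow> real (\<Prod>p\<in>T. p ^ e p) \<le> A B * real q"
      using many_smooth_in_shell[OF finT q prime_ge_2_nat[OF Tpr] P B(2)[unfolded s_def]]
      unfolding s_def by blast
    have Ek: "k0 \<le> e p" if "e \<in> E" "p \<in> T" for e p
      using PiE_mem[of e T "\<lambda>_. {k0..}" p] E(1) that by auto
    have "\<exists>z. \<forall>p\<in>T. [z = r p (e p)] (mod int p ^ Suc (e p))" for e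
      using chinese_remainder_prime_powers[OF finT, where r = "\<lambda>p. r p (e p)" and e = "\<lambda>p. Suc (e p)"] Tpr
      by blast
    then obtain z where z: "\<And>e p. p \<in> T \<Longrightarrow> [z e = r p (e p)] (mod int p ^ Suc (e p))"
      by metis
    define Q where "Q e = int (\<Prod>p\<in>T. p ^ e p) * int rad" for e
    define Y where "Y e = {x. \<bar>real_of_int x\<bar> \<le> B \<and> [x = z e] (mod Q e)}" for e
    have finY: "finite (Y e)" for e
      by (rule finite_subset[OF _ finite_abs_le[of B]]) (auto simp: Y_def)
    have Y: "int p ^ e p dvd poly f x" "\<not> int p ^ Suc (e p) dvd poly f x"
      if "e \<in> E" "x \<in> Y e" "p \<in> T" for e x p
    proof -
      have "p ^ Suc (e p) dvd (\<Prod>p\<in>T. p ^ Suc (e p))"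
        using finT that by (intro dvd_prodI)
      also have "\<dots> = (\<Prod>p\<in>T. p ^ e p) * rad" by (simp add: rad_def prod.distrib mult.commute)
      finally have "int (p ^ Suc (e p)) dvd Q e"
        unfolding Q_def by (simp only: int_dvd_int_iff flip: of_nat_mult)
      then have "[x = z e] (mod int p ^ Suc (e p))"
        using that(2) cong_dvd_modulus unfolding Y_def by fastforce
      then have "[x = r p (e p)] (mod int p ^ Suc (e p))"
        using z[OF that(3)] cong_trans by blast
      then have 1: "[poly f x = poly f (r p (e p))] (mod int p ^ Suc (e p))"
        by (rule cong_poly)
      then show "\<not> int p ^ Suc (e p) dvd poly f x"
        using r[OF that(3) Ek[OF that(1,3)]] cong_dvd_iff by blast
      have "[poly f x = poly f (r p (e p))] (mod int p ^ e p)"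
        using 1 by (rule cong_dvd_modulus) simp
      then show "int p ^ e p dvd poly f x"
        using r[OF that(3) Ek[OF that(1,3)]] cong_dvd_iff by blast
    qed
    have nz: "poly f x \<noteq> 0" if "e \<in> E" "x \<in> Y e" for e x
      using Y(2)[OF that q] by auto
    have mult: "multiplicity (int p) (poly f x) = e p" if "e \<in> E" "x \<in> Y e" "p \<in> T" for e x p
      using Y[OF that] by (intro multiplicity_eqI) auto
    have "Y e \<subseteq> X_set B" if e: "e \<in> E" for e
    proof
      fix x assume x: "x \<in> Y e"
      have xB: "\<bar>real_of_int x\<bar> \<le> B" using x by (simp add: Y_def)
      have "real_of_int \<bar>poly f x\<bar> powr \<epsilon> \<le> (C1 * B ^ n) powr \<epsilon>"
        using C1(2)[OF B(1) xB] \<epsilon> by (intro powr_mono2) auto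
      also have "\<dots> = c1 * (B ^ n) powr \<epsilon>"
        using B C1 by (simp add: c1_def powr_mult)
      also have "(B ^ n) powr \<epsilon> = B powr a"
        using B by (simp add: a_def powr_powr flip: powr_realpow)
      also have "c1 * B powr a \<le> real (\<Prod>p\<in>T. p ^ e p)"
        using E(4)[OF e] by (simp only: A_def)
      also have "(\<Prod>p\<in>T. p ^ e p) = S_part T (poly f x)"
        unfolding S_part_def using mult[OF e x] by (intro prod.cong) auto
      also have "real (S_part T (poly f x)) \<le> real (S_part S (poly f x))"
      proof -
        have "S_part T (poly f x) dvd S_part S (poly f x)"
          unfolding S_part_def using S(1) T(1) by (rule prod_dvd_prod_subset)
        moreover have "S_part S (poly f x) > 0"
          unfolding S_part_def using S(2) by (intro prod_pos) (auto simp: prime_gt_0_nat)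
        ultimately show ?thesis by (simp add: dvd_imp_le)
      qed
      finally show "x \<in> X_set B" using xB nz[OF e x] by (simp add: X_set_def)
    qed
    then have "card (\<Union>e\<in>E. Y e) \<le> card (X_set B)"
      using fin by (intro card_mono) auto
    moreover have "card (\<Union>e\<in>E. Y e) = (\<Sum>e\<in>E. card (Y e))"
    proof (rule card_UN_disjoint)
      show "\<forall>e\<in>E. \<forall>e'\<in>E. e \<noteq> e' \<longrightarrow> Y e \<inter> Y e' = {}"
      proof (intro ballI impI, rule ccontr)
        fix e e' assume e: "e \<in> E" "e' \<in> E" "e \<noteq> e'" "Y e \<inter> Y e' \<noteq> {}"
        then obtain x where "x \<in> Y e" "x \<in> Y e'" by blast
        then have "e p = e' p" if "p \<in> T" for p using mult e that by metis
        then have "e = e'" using e(1,2) E(1) by (intro PiE_ext[of e T _ e']) auto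
        then show False using e by simp
      qed
    qed (use E finY in auto)
    moreover have "B powr \<theta> / (2 * c1 * b) \<le> real (card (Y e))" if e: "e \<in> E" for e
    proof -
      have A0: "A B > 0" using c1 B by (simp add: A_def)
      have "real_of_int (Q e) = real (\<Prod>p\<in>T. p ^ e p) * real rad" by (simp add: Q_def)
      also have "\<dots> \<le> A B * real q * real rad" using E(5)[OF e] by (intro mult_right_mono) auto
      finally have Qle: "real_of_int (Q e) \<le> A B * b" by (simp add: b_def)
      have "real (\<Prod>p\<in>T. p ^ e p) > 0" using E(4)[OF e] A0 by linarith
      then have Q0: "Q e > 0" using rad unfolding Q_def by (simp only: of_nat_0_less_iff zero_less_mult_iff) simp
      have "B powr \<theta> / (2 * c1 * b) = B / (2 * (A B * b))"
        using B c1 by (simp add: A_def a(3) powr_diff)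
      also have "\<dots> \<le> B / (2 * Q e)"
        using Qle Q0 B A0 b by (intro divide_left_mono) auto
      also have "\<dots> \<le> real (card (Y e))"
        unfolding Y_def using Q0 Qle B(3) by (intro card_residue_class_ge) auto
      finally show ?thesis .
    qed
    then have "real (card E) * (B powr \<theta> / (2 * c1 * b)) \<le> (\<Sum>e\<in>E. real (card (Y e)))"
      by (rule sum_bounded_below)
    ultimately show ?thesis by (simp add: E(3) add.commute flip: of_nat_sum)
  qed

  define c where "c = \<eta> ^ (s - 1) / (2 * c1 * b)"
  \<comment> \<open>The part of the required power of \<open>P\<close> that does not grow with
    \<open>B\<close>.\<close>
  define P' where "P' = real P ^ (s * k0 + k0)"
  have "P' > 0" using P2 by (simp add: P'_def)
  then have "\<forall>\<^sub>F B in at_top. P' * B powr (a / 2) < c1 * B powr a"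
    using c1 a by real_asymp
  moreover have "\<forall>\<^sub>F B in at_top. c1 * B powr a * b \<le> B"
    using c1 a b by real_asymp
  moreover have "\<forall>\<^sub>F B :: real in at_top. 1 \<le> B" by (rule eventually_ge_at_top)
  ultimately have "\<forall>\<^sub>F B in at_top. c * B powr \<theta> * ln B ^ (s - 1) \<le> real (card (X_set B))"
  proof eventually_elim
    case (elim B)
    have lnB: "0 \<le> ln B" using elim by simp
    have "real (L B) \<le> \<eta> * ln B" using \<eta> lnB by (simp add: L_def)
    have "real P ^ (s * L B) = exp (real s * real (L B) * ln (real P))"
      using P2 by (simp add: exp_of_nat_mult[symmetric] powr_def flip: powr_realpow)
    also have "\<dots> \<le> exp (real s * (\<eta> * ln B) * ln (real P))"
      using \<open>real (L B) \<le> \<eta> * ln B\<close> P2 by (simp add: mult_left_mono mult_right_mono)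
    also have "real s * (\<eta> * ln B) * ln (real P) = (a / 2) * ln B"
      using s P2 by (simp add: \<eta>_def)
    also have "exp ((a / 2) * ln B) = B powr (a / 2)" using elim by (simp add: powr_def)
    finally have "P' * real P ^ (s * L B) \<le> P' * B powr (a / 2)"
      using \<open>P' > 0\<close> by (intro mult_left_mono) auto
    moreover have "real P ^ (s * (k0 + L B) + k0) = P' * real P ^ (s * L B)"
      by (simp add: P'_def distrib_left power_add)
    ultimately have "real P ^ (s * (k0 + L B) + k0) < A B" using elim(1) by (simp add: A_def)
    then have "(real (L B) + 1) ^ (s - 1) * (B powr \<theta> / (2 * c1 * b)) \<le> real (card (X_set B))"
      using elim by (intro main) (auto simp: A_def)
    moreover have "(\<eta> * ln B) ^ (s - 1) * (B powr \<theta> / (2 * c1 * b))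
      \<le> (real (L B) + 1) ^ (s - 1) * (B powr \<theta> / (2 * c1 * b))"
    proof (intro mult_right_mono power_mono)
      show "\<eta> * ln B \<le> real (L B) + 1" unfolding L_def by linarith
    qed (use \<eta> lnB c1 b in auto)
    ultimately show ?case by (simp add: c_def power_mult_distrib mult_ac)
  qed
  moreover have "c > 0" using \<eta> c1 b by (simp add: c_def)
  ultimately show ?thesis unfolding count s_def by blast
qed

section \<open>Combination of the two bounds\<close>

theorem theorem2p3:
  fixes f :: "int poly" and n :: nat and \<epsilon> :: real and S :: "nat set"
    and g :: "nat \<Rightarrow> nat" and s' :: nat
  assumes "degree f = n" and "n \<ge> 2"
    and "poly_discriminant f \<noteq> 0"
    and "0 < \<epsilon>" and "\<epsilon> < 1 / real n"
    and "finite S" and "\<forall>p\<in>S. prime p"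
    and "\<forall>p. prime p \<longrightarrow> g p = multiplicity (int p) (poly_discriminant f)"
    and "s' = card {p \<in> S. \<exists>x::int. [poly f x = 0] (mod int p ^ (g p + 1))}"
    and "s' > 0"
  shows "\<exists>c C :: real. 0 < c \<and> c < C \<and>
    (\<forall>\<^sub>F B in at_top.
       c * B powr (1 - real n * \<epsilon>) * ln B ^ (s' - 1) \<le> real (count_large_S_part f S \<epsilon> B) \<and>
       real (count_large_S_part f S \<epsilon> B) \<le> C * B powr (1 - real n * \<epsilon>) * ln B ^ (s' - 1))"
proof -
  define T where "T = {p \<in> S. \<exists>x::int. [poly f x = 0] (mod int p ^ (g p + 1))}"
  have n: "degree f = n" "n > 0" "degree f \<ge> 2" using assms(1,2) by auto
  have S: "\<And>p. p \<in> S \<Longrightarrow> prime p" using assms(7) by blast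
  have T_sub: "T \<subseteq> S" and T_card: "card T = s'"
    using assms(9) by (auto simp: T_def)
  then have "T \<noteq> {}" using assms(10) by auto
  note T = T_sub this T_card
  have not_dvd: "\<not> int p ^ (g p + 1) dvd poly_discriminant f" if "p \<in> S" for p
  proof -
    have p: "prime p" using S that by blast
    then have "\<not> is_unit (int p)" by auto
    then show ?thesis
      using power_dvd_iff_le_multiplicity[OF assms(3), of "int p" "g p + 1"] assms(8) p by simp
  qed
  \<comment> \<open>The upper bound takes \<open>D\<close> as a combination linear in the
    derivative, so one factor \<open>f' y\<close> moves into \<open>v\<close>.\<close>
  have "\<exists>u v. poly_discriminant f = u * poly f y + v * poly (pderiv f) y" for y
    using poly_discriminant_in_ideal[OF n(3), of y] by (metis mult.assoc power2_eq_square)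
  moreover have "\<not> int p ^ (g p + 1) dvd poly f x" if "p \<in> S - T" for p x
    using that by (auto simp: T_def cong_0_iff)
  ultimately obtain C where C: "C > 0" "\<forall>\<^sub>F B in at_top.
      real (count_large_S_part f S \<epsilon> B) \<le> C * B powr (1 - real n * \<epsilon>) * ln B ^ (s' - 1)"
    using count_large_S_part_upper[of f \<epsilon> "poly_discriminant f" S T g] assms(3-6) S T n by auto
  have "\<exists>k0. \<forall>k\<ge>k0. \<exists>x. int p ^ k dvd poly f x \<and> \<not> int p ^ Suc k dvd poly f x" if p: "p \<in> T" for p
  proof -
    obtain x where x: "int p ^ (g p + 1) dvd poly f x"
      using p by (auto simp: T_def cong_0_iff)
    obtain u v where "poly_discriminant f = u * poly f x + v * (poly (pderiv f) x)\<^sup>2"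
      using poly_discriminant_in_ideal[OF n(3)] by blast
    \<comment> \<open>\<open>p ^ (g p + 1)\<close> divides \<open>f x\<close> but not the
      discriminant, so it cannot divide the square of the derivative; this starts the Hensel
      lifting.\<close>
    then have "\<not> int p ^ (g p + 1) dvd (poly (pderiv f) x)\<^sup>2"
      using not_dvd[of p] p T(1) x by (metis dvd_add dvd_mult subsetD)
    moreover have "prime (int p)" using p T(1) S by auto
    ultimately show ?thesis
      using exists_exact_prime_power_value[OF _ x] by blast
  qed
  then obtain c where c: "c > 0" "\<forall>\<^sub>F B in at_top.
      c * B powr (1 - real n * \<epsilon>) * ln B ^ (s' - 1) \<le> real (count_large_S_part f S \<epsilon> B)"
    using count_large_S_part_lower[of f \<epsilon> S T] assms(4-6) S T n by auto
  \<comment> \<open>Enlarging \<open>C\<close> to \<open>C + c\<close> yields the strict inequality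
    between the constants.\<close>
  have "\<forall>\<^sub>F B in at_top. real (count_large_S_part f S \<epsilon> B)
      \<le> (C + c) * B powr (1 - real n * \<epsilon>) * ln B ^ (s' - 1)"
    using C(2) eventually_ge_at_top[of 1]
  proof eventually_elim
    case (elim B)
    have "C * B powr (1 - real n * \<epsilon>) * ln B ^ (s' - 1)
        \<le> (C + c) * B powr (1 - real n * \<epsilon>) * ln B ^ (s' - 1)"
      using c(1) elim(2) by (intro mult_right_mono) auto
    then show ?case using elim(1) by linarith
  qed
  with c(2) have "\<forall>\<^sub>F B in at_top.
       c * B powr (1 - real n * \<epsilon>) * ln B ^ (s' - 1) \<le> real (count_large_S_part f S \<epsilon> B) \<and>
       real (count_large_S_part f S \<epsilon> B) \<le> (C + c) * B powr (1 - real n * \<epsilon>) * ln B ^ (s' - 1)"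
    by (rule eventually_conj)
  moreover have "c < C + c" using C(1) by simp
  ultimately show ?thesis using c(1) by blast
qed

end
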